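(* The Interval Conjecture (IC) holds for the class of Gorenstein $h$-vectors of socle degree $4$. Precisely, if $(1,r,a,r,1)$ is a Gorenstein $h$-vector, then $(1,r,b,r,1)$ is also a Gorenstein $h$-vector for all integers $b$ such that $a\leq b\leq \binom{r+1}{2}$, the upper bound being sharp (i.e. $(1,r,b,r,1)$ is not a Gorenstein $h$-vector for $b>\binom{r+1}{2}$).
   Context: Let $k$ be a field of characteristic zero. All algebras are standard graded artinian algebras $A=R/I$, where $R=k[x_1,\dots,x_r]$, all $x_i$ have degree $1$, and $I$ is a homogeneous ideal of $R$ containing no nonzero forms of degree $1$. The $h$-vector of $A$ is $h(A)=(h_0,h_1,\dots,h_e)$, where $h_i=\dim_k A_i$ and $e$ is the last index with $\dim_k A_e>0$; thus $h_0=1$. The number $r=h_1$ is the codimension of $A$ (or of $h$), and $e$ is the socle degree. The socle of $A$ is the annihilator in $A$ of its homogeneous maximal ideal. $A$ is level of type $t$ if its socle is concentrated in degree $e$ and has dimension $t=h_e$; it is Gorenstein if it is level of type $1$. An $h$-vector is Gorenstein if it is the $h$-vector of some Gorenstein standard graded artinian algebra $A=k[x_1,\dots,x_r]/I$, where all $x_i$ have degree $1$ and $I$ is a homogeneous ideal containing no nonzero forms of degree $1$. Gorenstein $h$-vectors are symmetric. The IC holds for a class $\mathcal{C}$ of $h$-vectors if: whenever, for some index $i$ and some positive integer $\alpha$, both $(1,h_1,\dots,h_i,\dots,h_e)$ and $(1,h_1,\dots,h_i+\alpha,\dots,h_e)$ (differing only in degree $i$) belong to $\mathcal{C}$, then $(1,h_1,\dots,h_i+\beta,\dots,h_e)$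 belongs to $\mathcal{C}$ for every integer $\beta=0,1,\dots,\alpha$. *)

theory Defs
  imports
    Complex_Main
    "HOL-Library.Poly_Mapping"
    "HOL-Algebra.QuotRing"
    "HOL-Algebra.Embedded_Algebras"
begin

text \<open>
  A monomial is a finitely supported exponent function on the variables \<open>x\<^sub>0, x\<^sub>1, \<dots>\<close>; a
  polynomial is a finitely supported coefficient function on monomials. The multiplication of
  \<open>Poly_Mapping\<close> is convolution, i.e. the usual product of polynomials.
\<close>

type_synonym 'k mpoly = "(nat \<Rightarrow>\<^sub>0 nat) \<Rightarrow>\<^sub>0 'k"

text \<open>The ring \<open>R = k[x\<^sub>0, \<dots>, x\<^bsub>r-1\<^esub>]\<close>.\<close>

definition mpoly_ring :: "nat \<Rightarrow> 'k::field mpoly ring" where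
  "mpoly_ring r =
     \<lparr>carrier = {f. \<forall>m \<in> Poly_Mapping.keys f. Poly_Mapping.keys m \<subseteq> {..<r}},
      mult = (*), one = 1, zero = 0, add = (+)\<rparr>"

lemma cring_mpoly_ring: "cring (mpoly_ring r :: 'k::field mpoly ring)"
proof -
  have keys_add_mon: "Poly_Mapping.keys (m + m') \<subseteq> Poly_Mapping.keys m \<union> Poly_Mapping.keys m'"
    for m m' :: "nat \<Rightarrow>\<^sub>0 nat"
    by (rule Poly_Mapping.keys_add)
  show ?thesis
  proof (intro cringI abelian_groupI comm_monoidI)
    fix f g :: "'k mpoly"
    assume f: "f \<in> carrier (mpoly_ring r)" and g: "g \<in> carrier (mpoly_ring r)"
    show "f \<oplus>\<^bsub>mpoly_ring r\<^esub> g \<in> carrier (mpoly_ring r)"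
      using f g Poly_Mapping.keys_add[of f g] by (auto simp: mpoly_ring_def)
    show "f \<otimes>\<^bsub>mpoly_ring r\<^esub> g \<in> carrier (mpoly_ring r)"
    proof -
      have "Poly_Mapping.keys m \<subseteq> {..<r}" if m: "m \<in> Poly_Mapping.keys (f * g)" for m
      proof -
        obtain a b where ab: "m = a + b" "a \<in> Poly_Mapping.keys f" "b \<in> Poly_Mapping.keys g"
          using m keys_mult[of f g] by blast
        then have "Poly_Mapping.keys a \<subseteq> {..<r}" "Poly_Mapping.keys b \<subseteq> {..<r}"
          using f g by (simp_all add: mpoly_ring_def)
        then show ?thesis
          using keys_add_mon[of a b] ab(1) by blast
      qed
      then show ?thesis
        by (simp add: mpoly_ring_def)
    qed
  next
    fix f :: "'k mpoly"
    assume "f \<in> carrier (mpoly_ring r)"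
    then have "- f \<in> carrier (mpoly_ring r)"
      by (simp add: mpoly_ring_def in_keys_iff)
    then show "\<exists>g\<in>carrier (mpoly_ring r). g \<oplus>\<^bsub>mpoly_ring r\<^esub> f = \<zero>\<^bsub>mpoly_ring r\<^esub>"
      by (intro bexI[of _ "- f"]) (simp_all add: mpoly_ring_def)
  qed (simp_all add: mpoly_ring_def algebra_simps)
qed

definition mon_deg :: "(nat \<Rightarrow>\<^sub>0 nat) \<Rightarrow> nat" where
  "mon_deg m = (\<Sum>i \<in> Poly_Mapping.keys m. Poly_Mapping.lookup m i)"

text \<open>The space \<open>R\<^sub>d\<close> of forms of degree \<open>d\<close>, including \<open>0\<close>.\<close>

definition forms :: "nat \<Rightarrow> nat \<Rightarrow> 'k::field mpoly set" where
  "forms r d = {f \<in> carrier (mpoly_ring r). \<forall>m \<in> Poly_Mapping.keys f. mon_deg m = d}"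

definition hom_component :: "nat \<Rightarrow> 'k::field mpoly \<Rightarrow> 'k mpoly" where
  "hom_component d f =
     (\<Sum>m \<in> {m \<in> Poly_Mapping.keys f. mon_deg m = d}.
        Poly_Mapping.single m (Poly_Mapping.lookup f m))"

definition homogeneous_ideal :: "nat \<Rightarrow> 'k::field mpoly set \<Rightarrow> bool" where
  "homogeneous_ideal r I \<longleftrightarrow>
     ideal I (mpoly_ring r) \<and> (\<forall>f \<in> I. \<forall>d. hom_component d f \<in> I)"

definition artinian_ring :: "('a, 'b) ring_scheme \<Rightarrow> bool" where
  "artinian_ring A \<longleftrightarrow> ring A \<and>
     (\<forall>J :: nat \<Rightarrow> 'a set. (\<forall>n. ideal (J n) A \<and> J (Suc n) \<subseteq> J n) \<longrightarrow>
        (\<exists>N. \<forall>n\<ge>N. J n = J N))"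

definition standard_graded_artinian :: "nat \<Rightarrow> 'k::field mpoly set \<Rightarrow> bool" where
  "standard_graded_artinian r I \<longleftrightarrow>
     homogeneous_ideal r I \<and> (\<forall>f \<in> I \<inter> forms r 1. f = 0) \<and>
     artinian_ring (mpoly_ring r Quot I)"

text \<open>
  In the following, \<open>A = R/I\<close>. Its elements are cosets, and everything taken from \<open>R\<close> is
  pushed forward along the projection.
\<close>

definition quot_image :: "nat \<Rightarrow> 'k::field mpoly set \<Rightarrow> 'k mpoly set \<Rightarrow> 'k mpoly set set" where
  "quot_image r I S = (\<lambda>f. I +>\<^bsub>mpoly_ring r\<^esub> f) ` S"

text \<open>The copy of the ground field \<open>k\<close> in \<open>A\<close>, as the dimensions of \<open>Embedded_Algebras\<close> need it.\<close>

definition scalars :: "nat \<Rightarrow> 'k::field mpoly set \<Rightarrow> 'k mpoly set set" where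
  "scalars r I = quot_image r I (range (Poly_Mapping.single 0))"

definition graded_piece :: "nat \<Rightarrow> 'k::field mpoly set \<Rightarrow> nat \<Rightarrow> 'k mpoly set set" where
  "graded_piece r I d = quot_image r I (forms r d)"

definition has_kdim :: "nat \<Rightarrow> 'k::field mpoly set \<Rightarrow> 'k mpoly set set \<Rightarrow> nat \<Rightarrow> bool" where
  "has_kdim r I V n \<longleftrightarrow> ring.dimension (mpoly_ring r Quot I) n (scalars r I) V"

text \<open>
  \<open>h = [h\<^sub>0, \<dots>, h\<^sub>e]\<close>. For the degenerate case \<open>A = 0\<close>, which has no last nonzero degree, there
  is no such \<open>h\<close>.
\<close>

definition has_h_vector :: "nat \<Rightarrow> 'k::field mpoly set \<Rightarrow> nat list \<Rightarrow> bool" where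
  "has_h_vector r I h \<longleftrightarrow>
     h \<noteq> [] \<and> last h > 0 \<and>
     (\<forall>d. has_kdim r I (graded_piece r I d) (if d < length h then h ! d else 0))"

text \<open>The homogeneous maximal ideal of \<open>A\<close>: classes of polynomials with zero constant term.\<close>

definition hom_max_ideal :: "nat \<Rightarrow> 'k::field mpoly set \<Rightarrow> 'k mpoly set set" where
  "hom_max_ideal r I =
     quot_image r I {f \<in> carrier (mpoly_ring r). Poly_Mapping.lookup f 0 = 0}"

definition socle :: "nat \<Rightarrow> 'k::field mpoly set \<Rightarrow> 'k mpoly set set" where
  "socle r I =
     {a \<in> carrier (mpoly_ring r Quot I).
        \<forall>b \<in> hom_max_ideal r I. a \<otimes>\<^bsub>mpoly_ring r Quot I\<^esub> b = \<zero>\<^bsub>mpoly_ring r Quot I\<^esub>}"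

definition level_of_type :: "nat \<Rightarrow> 'k::field mpoly set \<Rightarrow> nat \<Rightarrow> bool" where
  "level_of_type r I t \<longleftrightarrow>
     (\<exists>h. has_h_vector r I h \<and> socle r I \<subseteq> graded_piece r I (length h - 1) \<and>
        has_kdim r I (socle r I) t \<and> t = last h)"

definition gorenstein :: "nat \<Rightarrow> 'k::field mpoly set \<Rightarrow> bool" where
  "gorenstein r I \<longleftrightarrow> level_of_type r I 1"

text \<open>The type argument carries the ground field \<open>k\<close>.\<close>

definition gorenstein_h_vector :: "'k::field itself \<Rightarrow> nat list \<Rightarrow> bool" where
  "gorenstein_h_vector K h \<longleftrightarrow>
     (\<exists>r (I :: 'k mpoly set).
        standard_graded_artinian r I \<and> gorenstein r I \<and> has_h_vector r I h)"

definition interval_conjecture_for :: "nat list set \<Rightarrow> bool" where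
  "interval_conjecture_for C \<longleftrightarrow>
     (\<forall>h i \<alpha>. i < length h \<longrightarrow> \<alpha> > 0 \<longrightarrow> h \<in> C \<longrightarrow> h[i := h ! i + \<alpha>] \<in> C \<longrightarrow>
        (\<forall>\<beta>\<le>\<alpha>. h[i := h ! i + \<beta>] \<in> C))"

end

theory Submission
  imports Defs
begin

text \<open>
  By Macaulay duality a Gorenstein algebra of socle degree 4 is \<open>R/I\<^sub>\<phi>\<close> with
  \<open>I\<^sub>\<phi> = {f. \<forall>g. \<phi> (f g) = 0}\<close> for a linear functional \<open>\<phi>\<close> on \<open>R\<^sub>4\<close>, and \<open>h\<^sub>2\<close> is the rank of the
  form \<open>(f, g) \<mapsto> \<phi> (f g)\<close> on \<open>R\<^sub>2\<close>. If this rank is not maximal, some quadric \<open>q \<noteq> 0\<close> lies in the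
  radical. Pick a point \<open>p\<close> with \<open>q p \<noteq> 0\<close> and replace \<open>\<phi>\<close> by \<open>\<phi> + ev\<^sub>p\<close>, which amounts to adding the
  fourth power of a linear form to the dual quartic. Testing against \<open>q\<close> shows that the new
  radical is the hyperplane \<open>{f. f p = 0}\<close> of the old one, so \<open>h\<^sub>2\<close> grows by exactly one. A linear form
  killed by the new functional has all its multiples of degree 2 in the new, hence in the old
  radical, so it is already killed by \<open>\<phi>\<close>, and \<open>h\<^sub>1\<close> does not change.
\<close>

section \<open>Dimensions of finite-dimensional subspaces\<close>

text \<open>The dual quartic is never written down. A functional on polynomials replaces it, so
  membership in the ideal becomes the vanishing of a bilinear form and no differentiation occurs.
  Evaluation at \<open>p\<close> is multiplicative, so adding it perturbs the form on R_2 by f(p)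
  g(p), which has rank one. If f is in the new radical, pairing f with \<open>q\<close> leaves only
  f(p) q(p) = 0, because \<open>q\<close> pairs to zero with all of R_2 under the old functional;
  hence f(p) = 0, and then the old form kills f as well. The entries h_3 and h_4 come from symmetry:
  the rank of the pairing between R_d and the forms of complementary degree is both h_d and the
  entry in that degree. What shapes much of the text is that a dimension in the quotient is an
  inductively defined relation over a copy of k. Each one is converted into an identity dim V = n +
  dim (V \<inter> I) between spaces of polynomials, kept additive to avoid truncated
  subtraction.\<close>

context vector_space
begin

text \<open>\<open>dim\<close> is the \<open>card\<close> of a basis, and \<open>card\<close> is 0
  on infinite sets. As the polynomials form an infinite-dimensional space, a finite set
  \<open>T\<close> whose span contains \<open>V\<close> stands for finite dimension here and
  below.\<close>

lemma finite_dim_subspace_basis: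
  assumes "subspace V" "V \<subseteq> span T" "finite T"
  obtains B where "finite B" "B \<subseteq> V" "independent B" "span B = V" "card B = dim V"
proof -
  obtain B where B: "B \<subseteq> V" "independent B" "V \<subseteq> span B" "card B = dim V"
    using basis_exists by blast
  have "finite B" using independent_span_bound[OF assms(3) B(2)] B(1) assms(2) by blast
  moreover have "span B = V" using B(1,3) assms(1) by (simp add: span_subspace)
  ultimately show thesis using that B by blast
qed

lemma dim_mono_finite:
  assumes "V \<subseteq> W" "W \<subseteq> span T" "finite T"
  shows "dim V \<le> dim W"
proof -
  obtain B where B: "B \<subseteq> V" "independent B" "V \<subseteq> span B" "card B = dim V"
    using basis_exists by blast
  obtain C where C: "C \<subseteq> W" "independent C" "W \<subseteq> span C" "card C = dim W"
    using basis_exists by blast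
  have "finite C" using independent_span_bound[OF assms(3) C(2)] C(1) assms(2) by blast
  then show ?thesis
    using independent_span_bound[OF _ B(2), of C] B C assms(1) by auto
qed

lemma dim_span_insert_finite:
  assumes "subspace U" "U \<subseteq> span T" "finite T" "q \<notin> U"
  shows "dim (span (insert q U)) = dim U + 1"
proof -
  obtain B where B: "finite B" "B \<subseteq> U" "independent B" "span B = U" "card B = dim U"
    using finite_dim_subspace_basis[OF assms(1-3)] .
  have q: "q \<notin> B" using B(2) assms(4) by blast
  have "independent (insert q B)" using B assms(4) by (simp add: independent_insertI)
  moreover have "span (insert q B) = span (insert q U)"
    using B(2,4) by (metis span_insert span_span)
  ultimately have "dim (span (insert q U)) = card (insert q B)"
    by (metis dim_span_eq_card_independent)
  then show ?thesis using B(1,5) q by simp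
qed

lemma subspace_eq_of_dim_le:
  assumes "subspace V" "V \<subseteq> W" "W \<subseteq> span T" "finite T" "dim W \<le> dim V"
  shows "V = W"
proof (rule ccontr)
  assume "V \<noteq> W"
  then obtain q where q: "q \<in> W" "q \<notin> V" using assms(2) by blast
  have "dim (span (insert q V)) = dim V + 1"
    using dim_span_insert_finite[OF assms(1) _ assms(4) q(2)] assms(2,3) by blast
  moreover have "dim (insert q V) \<le> dim W"
    using dim_mono_finite[OF _ assms(3,4), of "insert q V"] q assms(2) by blast
  ultimately show False using assms(5) by simp
qed

text \<open>Every \<open>v\<close> differs from a multiple of \<open>q\<close> by an element of the
  kernel, so the kernel and \<open>q\<close> together span \<open>V\<close>. This is the source of
  the exact increase by one in degree 2.\<close>

lemma dim_kernel_functional: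
  assumes lin: "Vector_Spaces.linear scale (*) \<phi>"
    and V: "subspace V" "V \<subseteq> span T" "finite T" and q: "q \<in> V" "\<phi> q \<noteq> 0"
  shows "dim V = dim {v \<in> V. \<phi> v = 0} + 1"
proof -
  interpret L: Vector_Spaces.linear scale "(*)" \<phi> by fact
  let ?U = "{v \<in> V. \<phi> v = 0}"
  have U: "subspace ?U"
    using V(1) by (auto simp: subspace_def L.add L.scale L.zero)
  have "V \<subseteq> span (insert q ?U)"
  proof
    fix v assume v: "v \<in> V"
    have "v - scale (\<phi> v / \<phi> q) q \<in> ?U"
      using v q V(1) by (simp add: L.diff L.scale subspace_diff subspace_scale)
    then show "v \<in> span (insert q ?U)"
      by (metis (no_types, lifting) span_base span_breakdown_eq)
  qed
  moreover have "span (insert q ?U) \<subseteq> V"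
    using q V(1) by (intro span_minimal) auto
  ultimately have "V = span (insert q ?U)" by blast
  moreover have "dim (span (insert q ?U)) = dim ?U + 1"
    by (rule dim_span_insert_finite[OF U _ V(3)]) (use V(2) q in auto)
  ultimately show ?thesis by simp
qed

text \<open>Each functional cuts the dimension by at most one, and only when it does not vanish on
  what is left.\<close>

lemma dim_le_common_kernel:
  assumes "finite B" and lin: "\<And>b. b \<in> B \<Longrightarrow> Vector_Spaces.linear scale (*) (\<phi> b)"
    and V: "subspace V" "V \<subseteq> span T" "finite T"
  shows "dim V \<le> card B + dim {v \<in> V. \<forall>b\<in>B. \<phi> b v = 0}"
  using assms(1) lin
proof (induction B)
  case empty
  then show ?case by simp
next
  case (insert b B)
  let ?K = "{v \<in> V. \<forall>b\<in>B. \<phi> b v = 0}"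
  have lB: "Vector_Spaces.linear scale (*) (\<phi> c)" if "c \<in> B" for c
    using insert.prems that by simp
  have add: "\<phi> c (x + y) = \<phi> c x + \<phi> c y" and sc: "\<phi> c (scale a x) = a * \<phi> c x"
    if "c \<in> B" for c x y a
    using lB[OF that] by (simp_all add: Vector_Spaces.linear_iff)
  have ze: "\<phi> c 0 = 0" if "c \<in> B" for c
    using sc[OF that, of 0 0] by simp
  have K: "subspace ?K"
    using V(1) by (auto simp: subspace_def add sc ze)
  have eq: "{v \<in> V. \<forall>b\<in>insert b B. \<phi> b v = 0} = {v \<in> ?K. \<phi> b v = 0}" by auto
  have IH: "dim V \<le> card B + dim ?K" using insert.IH insert.prems by simp
  have "dim ?K \<le> 1 + dim {v \<in> ?K. \<phi> b v = 0}"
  proof (cases "\<exists>q\<in>?K. \<phi> b q \<noteq> 0")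
    case True
    then obtain q where q: "q \<in> ?K" "\<phi> b q \<noteq> 0" by blast
    have "?K \<subseteq> span T" using V(2) by auto
    then show ?thesis
      using dim_kernel_functional[OF insert.prems K _ V(3) q] by simp
  next
    case False
    then have "{v \<in> ?K. \<phi> b v = 0} = ?K" by blast
    then show ?thesis by simp
  qed
  then show ?case using IH insert.hyps unfolding eq by simp
qed

text \<open>A basis of \<open>U\<close> is extended to one of \<open>V\<close>, and \<open>C\<close>
  consists of the added vectors. Its span represents the quotient of \<open>V\<close> by
  \<open>U\<close> inside \<open>V\<close>.\<close>

lemma subspace_complement_finite:
  assumes "subspace U" "subspace V" "U \<subseteq> V" "V \<subseteq> span T" "finite T"
  obtains C where "finite C" "C \<subseteq> V" "independent C" "span C \<inter> U = {0}"
    "card C + dim U = dim V" "\<And>v. v \<in> V \<Longrightarrow> \<exists>c\<in>span C. v - c \<in> U"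
proof -
  obtain B where B: "finite B" "B \<subseteq> U" "independent B" "span B = U" "card B = dim U"
    using finite_dim_subspace_basis[OF assms(1) _ assms(5)] assms(3,4) by blast
  obtain D where D: "B \<subseteq> D" "D \<subseteq> V" "independent D" "V \<subseteq> span D"
    using maximal_independent_subset_extend[of B V] B assms(3) by blast
  have fD: "finite D" using independent_span_bound[OF assms(5) D(3)] D(2) assms(4) by blast
  have dD: "card D = dim V" using basis_card_eq_dim D by blast
  let ?C = "D - B"
  have "card ?C + dim U = dim V"
    using B(1,5) D(1) fD dD by (metis card_Diff_subset card_mono le_add_diff_inverse2)
  moreover have "span ?C \<inter> U = {0}"
  proof -
    \<comment> \<open>The coordinates of \<open>x\<close> with respect to \<open>D\<close> are
      supported both on \<open>D - B\<close> and on \<open>B\<close>, hence all vanish.\<close>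
    have "x = 0" if x: "x \<in> span ?C" "x \<in> span B" for x
    proof -
      have "representation D x = representation ?C x" "representation D x = representation B x"
        by (rule representation_extend[OF D(3)]; use x D(1) in auto)+
      then have "representation D x b = 0" for b
        by (metis DiffD2 representation_ne_zero)
      then show ?thesis
        using sum_nonzero_representation_eq[OF D(3), of x] x(2) span_mono[OF D(1)] by auto
    qed
    then have "span ?C \<inter> span B = {0}" by (auto simp: span_zero)
    then show ?thesis using B(4) by simp
  qed
  moreover have "\<exists>c\<in>span ?C. v - c \<in> U" if "v \<in> V" for v
  proof -
    have "v \<in> span (?C \<union> B)" using that D(1,4) by (simp add: Un_absorb2 subset_iff)
    then obtain c u where "v = c + u" "c \<in> span ?C" "u \<in> span B"
      unfolding span_Un by blast
    then show ?thesis using B(4) by auto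
  qed
  moreover have "independent ?C" using D(3) independent_mono by blast
  ultimately show thesis using that[of ?C] fD D(2) by blast
qed


text \<open>A vector \<open>y\<close> orthogonal to a complement \<open>C\<close> of the left
  radical is orthogonal to all of \<open>V\<close>. The right radical is therefore cut out of
  \<open>W\<close> by \<open>card C\<close> functionals, that is, by dim V minus the dimension of
  the left radical.\<close>

lemma pairing_rank_le:
  assumes lin: "\<And>x. Vector_Spaces.linear scale (*) (\<beta> x)"
    "\<And>y. Vector_Spaces.linear scale (*) (\<lambda>x. \<beta> x y)"
    and V: "subspace V" "V \<subseteq> span S" "finite S" and W: "subspace W" "W \<subseteq> span T" "finite T"
  shows "dim W + dim {x \<in> V. \<forall>y\<in>W. \<beta> x y = 0} \<le> dim V + dim {y \<in> W. \<forall>x\<in>V. \<beta> x y = 0}"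
proof -
  let ?L = "{x \<in> V. \<forall>y\<in>W. \<beta> x y = 0}"
  have add: "\<beta> (x + x') y = \<beta> x y + \<beta> x' y" and sc: "\<beta> (scale c x) y = c * \<beta> x y" for x x' y c
    using lin(2) by (simp_all add: Vector_Spaces.linear_iff)
  have ze: "\<beta> 0 y = 0" for y using sc[of 0 0 y] by simp
  have L: "subspace ?L" using V(1) by (auto simp: subspace_def add sc ze)
  obtain C where C: "finite C" "C \<subseteq> V" "card C + dim ?L = dim V"
    "\<And>v. v \<in> V \<Longrightarrow> \<exists>c\<in>span C. v - c \<in> ?L"
    using subspace_complement_finite[OF L V(1) _ V(2,3)] by (metis (no_types, lifting) mem_Collect_eq subsetI)
  have "{y \<in> W. \<forall>x\<in>C. \<beta> x y = 0} \<subseteq> {y \<in> W. \<forall>x\<in>V. \<beta> x y = 0}"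
  proof safe
    fix y v assume y: "y \<in> W" "\<forall>x\<in>C. \<beta> x y = 0" and v: "v \<in> V"
    obtain c where c: "c \<in> span C" "v - c \<in> ?L" using C(4)[OF v] by blast
    have "\<beta> c y = 0"
      using c(1)
    proof (induction rule: span_induct_alt)
      case base then show ?case by (simp add: ze)
    next
      case (step a x z) then show ?case using y(2) by (simp add: add sc)
    qed
    moreover have "\<beta> (v - c) y = 0" using c(2) y(1) by simp
    ultimately show "\<beta> v y = 0" using add[of "v - c" c y] by simp
  qed
  then have "{y \<in> W. \<forall>x\<in>C. \<beta> x y = 0} = {y \<in> W. \<forall>x\<in>V. \<beta> x y = 0}"
    using C(2) by blast
  then show ?thesis
    using dim_le_common_kernel[OF C(1) lin(1) W, of "\<lambda>x. x"] C(3) by simp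
qed

text \<open>Row rank equals column rank: the inequality is applied to the pairing and to its
  transpose.\<close>

lemma pairing_rank_eq:
  assumes lin: "\<And>x. Vector_Spaces.linear scale (*) (\<beta> x)"
    "\<And>y. Vector_Spaces.linear scale (*) (\<lambda>x. \<beta> x y)"
    and V: "subspace V" "V \<subseteq> span S" "finite S" and W: "subspace W" "W \<subseteq> span T" "finite T"
  shows "dim W + dim {x \<in> V. \<forall>y\<in>W. \<beta> x y = 0} = dim V + dim {y \<in> W. \<forall>x\<in>V. \<beta> x y = 0}"
  using pairing_rank_le[of \<beta>, OF lin V W] pairing_rank_le[of "\<lambda>y x. \<beta> x y", OF lin(2) lin(1) W V]
  by simp

end

section \<open>Polynomials as a vector space\<close>

text \<open>Scaling is multiplication by a constant polynomial, in agreement with the copy of k in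
  \<open>scalars\<close>. This makes ideals subspaces and lets spans of polynomials be compared with
  line extensions in the quotient.\<close>

definition smul :: "'k::field \<Rightarrow> 'k mpoly \<Rightarrow> 'k mpoly" where
  "smul c f = Poly_Mapping.single 0 c * f"

lemma lookup_smul: "Poly_Mapping.lookup (smul c f) m = c * Poly_Mapping.lookup f m"
  unfolding smul_def mult_map_scale_conv_mult[symmetric]
  by (auto simp: map.rep_eq when_def)

interpretation mp: vector_space "smul :: 'k::field \<Rightarrow> 'k mpoly \<Rightarrow> 'k mpoly"
  by unfold_locales (auto intro!: poly_mapping_eqI simp: lookup_smul lookup_add algebra_simps)

lemma smul_mult_left: "smul c f * g = smul c (f * g)"
  and smul_mult_right: "f * smul c g = smul c (f * g)"
  by (simp_all add: smul_def algebra_simps)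

lemma smul_single: "smul c (Poly_Mapping.single m a) = Poly_Mapping.single m (c * a)"
  by (auto intro!: poly_mapping_eqI simp: lookup_smul lookup_single when_def)

lemma mpoly_sum_monomials:
  "(\<Sum>m\<in>Poly_Mapping.keys f. smul (Poly_Mapping.lookup f m) (Poly_Mapping.single m 1)) = (f :: 'k::field mpoly)"
proof (rule poly_mapping_eqI)
  fix n
  have "(\<Sum>m\<in>Poly_Mapping.keys f. Poly_Mapping.lookup f m when m = n) = Poly_Mapping.lookup f n"
    by (simp add: when_def in_keys_iff)
  then show "Poly_Mapping.lookup (\<Sum>m\<in>Poly_Mapping.keys f. smul (Poly_Mapping.lookup f m) (Poly_Mapping.single m 1)) n
      = Poly_Mapping.lookup f n"
    by (simp add: lookup_sum smul_single lookup_single)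
qed

text \<open>Linear functionals are encoded by their values \<open>w\<close> on monomials.\<close>

definition coeff_sum :: "((nat \<Rightarrow>\<^sub>0 nat) \<Rightarrow> 'k) \<Rightarrow> 'k::field mpoly \<Rightarrow> 'k" where
  "coeff_sum w f = (\<Sum>m\<in>Poly_Mapping.keys f. Poly_Mapping.lookup f m * w m)"

lemma coeff_sum_superset:
  "finite A \<Longrightarrow> Poly_Mapping.keys f \<subseteq> A \<Longrightarrow> coeff_sum w f = (\<Sum>m\<in>A. Poly_Mapping.lookup f m * w m)"
  unfolding coeff_sum_def by (intro sum.mono_neutral_left) (auto simp: in_keys_iff)

lemma coeff_sum_add: "coeff_sum w (f + g) = coeff_sum w f + coeff_sum w g"
proof -
  let ?A = "Poly_Mapping.keys f \<union> Poly_Mapping.keys g"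
  have "coeff_sum w h = (\<Sum>m\<in>?A. Poly_Mapping.lookup h m * w m)" if "Poly_Mapping.keys h \<subseteq> ?A" for h
    using that by (intro coeff_sum_superset) auto
  then show ?thesis
    using keys_add[of f g] by (simp add: lookup_add distrib_right sum.distrib)
qed

lemma coeff_sum_smul: "coeff_sum w (smul c f) = c * coeff_sum w f"
proof -
  have "Poly_Mapping.keys (smul c f) \<subseteq> Poly_Mapping.keys f"
    by (auto simp: in_keys_iff lookup_smul)
  then show ?thesis
    by (simp add: coeff_sum_superset[of "Poly_Mapping.keys f"] lookup_smul sum_distrib_left mult.assoc)
qed

lemma vector_space_mult: "vector_space ((*) :: 'k::field \<Rightarrow> 'k \<Rightarrow> 'k)"
  by unfold_locales (simp_all add: algebra_simps)

lemma linear_coeff_sum: "Vector_Spaces.linear smul (*) (coeff_sum w)"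
  unfolding Vector_Spaces.linear_iff
  by (auto simp: coeff_sum_add coeff_sum_smul mp.vector_space_axioms vector_space_mult)

lemma linear_coeff_sum_mult:
  "Vector_Spaces.linear smul (*) (\<lambda>g. coeff_sum w (f * g))"
  "Vector_Spaces.linear smul (*) (\<lambda>f. coeff_sum w (f * g))"
  unfolding Vector_Spaces.linear_iff
  by (auto simp: coeff_sum_add coeff_sum_smul distrib_left distrib_right smul_mult_left smul_mult_right
      mp.vector_space_axioms vector_space_mult)

lemma coeff_sum_0 [simp]: "coeff_sum w 0 = 0"
  by (simp add: coeff_sum_def)

lemma coeff_sum_single: "coeff_sum w (Poly_Mapping.single m c) = c * w m"
  by (simp add: coeff_sum_def)

lemma coeff_sum_sum: "coeff_sum w (\<Sum>x\<in>A. f x) = (\<Sum>x\<in>A. coeff_sum w (f x))"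
  by (induction A rule: infinite_finite_induct) (auto simp: coeff_sum_add)

lemma coeff_sum_weight_add: "coeff_sum (\<lambda>m. w m + v m) f = coeff_sum w f + coeff_sum v f"
  by (simp add: coeff_sum_def distrib_left sum.distrib)

lemma coeff_sum_mult:
  "coeff_sum w (f * g) = (\<Sum>m\<in>Poly_Mapping.keys f. \<Sum>n\<in>Poly_Mapping.keys g.
     Poly_Mapping.lookup f m * Poly_Mapping.lookup g n * w (m + n))"
proof -
  have "coeff_sum w (f * g) = coeff_sum w
     ((\<Sum>m\<in>Poly_Mapping.keys f. smul (Poly_Mapping.lookup f m) (Poly_Mapping.single m 1)) *
      (\<Sum>m\<in>Poly_Mapping.keys g. smul (Poly_Mapping.lookup g m) (Poly_Mapping.single m 1)))"
    by (simp only: mpoly_sum_monomials)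
  then show ?thesis
    by (simp add: sum_product coeff_sum_sum smul_single mult_single coeff_sum_single)
qed

section \<open>Monomials of a given degree\<close>

lemma mon_deg_superset:
  "finite A \<Longrightarrow> Poly_Mapping.keys m \<subseteq> A \<Longrightarrow> mon_deg m = (\<Sum>i\<in>A. Poly_Mapping.lookup m i)"
  unfolding mon_deg_def by (intro sum.mono_neutral_left) (auto simp: in_keys_iff)

lemma mon_deg_add: "mon_deg (m + n) = mon_deg m + mon_deg n"
proof -
  let ?A = "Poly_Mapping.keys m \<union> Poly_Mapping.keys n"
  have "mon_deg h = (\<Sum>i\<in>?A. Poly_Mapping.lookup h i)" if "Poly_Mapping.keys h \<subseteq> ?A" for h
    using that by (intro mon_deg_superset) auto
  then show ?thesis
    using keys_add[of m n] by (simp add: lookup_add sum.distrib)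
qed

lemma mon_deg_single [simp]: "mon_deg (Poly_Mapping.single i k) = k"
  by (simp add: mon_deg_def)

lemma mon_deg_0_iff: "mon_deg m = 0 \<longleftrightarrow> m = 0"
  by (auto simp: mon_deg_def in_keys_iff intro!: poly_mapping_eqI) 

lemma keys_add_nat: "Poly_Mapping.keys (m + n) = Poly_Mapping.keys m \<union> Poly_Mapping.keys n"
  for m n :: "nat \<Rightarrow>\<^sub>0 nat"
  by (auto simp: in_keys_iff lookup_add)

definition monomials :: "nat \<Rightarrow> nat \<Rightarrow> (nat \<Rightarrow>\<^sub>0 nat) set" where
  "monomials r d = {m. Poly_Mapping.keys m \<subseteq> {..<r} \<and> mon_deg m = d}"

lemma monomials_add: "m \<in> monomials r a \<Longrightarrow> n \<in> monomials r b \<Longrightarrow> m + n \<in> monomials r (a + b)"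
  by (auto simp: monomials_def mon_deg_add keys_add_nat)

lemma lookup_le_mon_deg: "Poly_Mapping.lookup m i \<le> mon_deg m"
proof (cases "i \<in> Poly_Mapping.keys m")
  case True
  then show ?thesis unfolding mon_deg_def by (intro member_le_sum) auto
qed (simp add: in_keys_iff)

lemma finite_monomials: "finite (monomials r d)"
proof -
  have "Poly_Mapping.lookup ` monomials r d \<subseteq>
    {f. \<forall>i. (i \<in> {..<r} \<longrightarrow> f i \<in> {..d}) \<and> (i \<notin> {..<r} \<longrightarrow> f i = 0)}"
  proof (rule image_subsetI)
    fix m assume "m \<in> monomials r d"
    then have m: "Poly_Mapping.keys m \<subseteq> {..<r}" "mon_deg m = d" by (simp_all add: monomials_def)
    have "Poly_Mapping.lookup m i \<le> d" for i using lookup_le_mon_deg[of m i] m(2) by simp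
    moreover have "Poly_Mapping.lookup m i = 0" if "i \<notin> {..<r}" for i
      using m(1) that by (meson in_keys_iff subsetD)
    ultimately show "Poly_Mapping.lookup m \<in> {f. \<forall>i. (i \<in> {..<r} \<longrightarrow> f i \<in> {..d}) \<and> (i \<notin> {..<r} \<longrightarrow> f i = 0)}"
      by simp
  qed
  then have "finite (Poly_Mapping.lookup ` monomials r d)"
    by (rule finite_subset) (intro finite_set_of_finite_funs; simp)
  then show ?thesis
    by (rule finite_imageD) (auto intro: inj_onI poly_mapping_eqI)
qed

lemma monomials_Suc_obtain:
  assumes "m \<in> monomials r (Suc d)"
  obtains i n where "i < r" "n \<in> monomials r d" "m = Poly_Mapping.single i 1 + n"
proof -
  have "mon_deg m \<noteq> 0" using assms by (simp add: monomials_def)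
  then obtain i where i: "i \<in> Poly_Mapping.keys m" unfolding mon_deg_def by (meson sum.not_neutral_contains_not_neutral)
  define n where "n = m - Poly_Mapping.single i 1"
  have eq: "m = Poly_Mapping.single i 1 + n"
    using i by (intro poly_mapping_eqI) (auto simp: n_def lookup_add lookup_minus lookup_single when_def in_keys_iff)
  have "Poly_Mapping.keys n \<subseteq> Poly_Mapping.keys m" unfolding eq by (auto simp: keys_add_nat)
  moreover have "mon_deg n = d" using assms eq by (simp add: monomials_def mon_deg_add)
  ultimately have "n \<in> monomials r d" using assms by (auto simp: monomials_def)
  moreover have "i < r" using assms i by (auto simp: monomials_def)
  ultimately show thesis using that eq by blast
qed

lemma monomials_factor:
  "m \<in> monomials r (a + b) \<Longrightarrow> \<exists>p\<in>monomials r a. \<exists>q\<in>monomials r b. m = p + q"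
proof (induction a arbitrary: m)
  case 0
  then show ?case by (intro bexI[of _ 0] bexI[of _ m]) (auto simp: monomials_def mon_deg_def)
next
  case (Suc a)
  obtain i n where n: "i < r" "n \<in> monomials r (a + b)" "m = Poly_Mapping.single i 1 + n"
    using Suc.prems monomials_Suc_obtain[of m r "a + b"] by auto
  obtain p q where pq: "p \<in> monomials r a" "q \<in> monomials r b" "n = p + q"
    using Suc.IH[OF n(2)] by blast
  have "Poly_Mapping.single i 1 \<in> monomials r 1" using n(1) by (simp add: monomials_def)
  then have "Poly_Mapping.single i 1 + p \<in> monomials r (Suc a)"
    using monomials_add pq(1) by fastforce
  then show ?case
    using pq n(3) by (metis add.assoc)
qed

section \<open>Forms of degree d and their monomial bases\<close>

lemma subspace_carrier: "mp.subspace (carrier (mpoly_ring r))"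
  unfolding mp.subspace_def
proof (intro conjI ballI allI)
  show "0 \<in> carrier (mpoly_ring r)" by (simp add: mpoly_ring_def)
  show "f + g \<in> carrier (mpoly_ring r)" if "f \<in> carrier (mpoly_ring r)" "g \<in> carrier (mpoly_ring r)"
    for f g :: "'a mpoly"
    using that keys_add[of f g] by (auto simp: mpoly_ring_def)
  show "smul c f \<in> carrier (mpoly_ring r)" if "f \<in> carrier (mpoly_ring r)" for c and f :: "'a mpoly"
    using that by (auto simp: mpoly_ring_def in_keys_iff lookup_smul)
qed

lemma mpoly_ring_simps [simp]:
  "f \<otimes>\<^bsub>mpoly_ring r\<^esub> g = f * g" "f \<oplus>\<^bsub>mpoly_ring r\<^esub> g = f + g"
  "\<zero>\<^bsub>mpoly_ring r\<^esub> = 0" "\<one>\<^bsub>mpoly_ring r\<^esub> = 1"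
  by (simp_all add: mpoly_ring_def)

lemma carrier_mult:
  "f \<in> carrier (mpoly_ring r) \<Longrightarrow> g \<in> carrier (mpoly_ring r) \<Longrightarrow> f * g \<in> carrier (mpoly_ring r)"
  using monoid.m_closed[OF ring.is_monoid[OF cring.axioms(1)[OF cring_mpoly_ring]], of f r g] by simp

lemma single_in_carrier:
  "Poly_Mapping.keys m \<subseteq> {..<r} \<Longrightarrow> Poly_Mapping.single m c \<in> carrier (mpoly_ring r)"
  by (simp add: mpoly_ring_def)

lemma forms_iff: "f \<in> forms r d \<longleftrightarrow> Poly_Mapping.keys f \<subseteq> monomials r d"
  by (auto simp: forms_def mpoly_ring_def monomials_def)

lemma forms_subset_carrier: "forms r d \<subseteq> carrier (mpoly_ring r)"
  by (auto simp: forms_def)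

lemma subspace_forms: "mp.subspace (forms r d)"
  unfolding mp.subspace_def
proof (intro conjI ballI allI)
  show "0 \<in> forms r d" by (simp add: forms_iff)
  show "f + g \<in> forms r d" if "f \<in> forms r d" "g \<in> forms r d" for f g :: "'a mpoly"
    using that keys_add[of f g] by (auto simp: forms_iff)
  show "smul c f \<in> forms r d" if "f \<in> forms r d" for c and f :: "'a mpoly"
    using that by (auto simp: forms_iff in_keys_iff lookup_smul)
qed

lemma single_in_forms: "m \<in> monomials r d \<Longrightarrow> Poly_Mapping.single m c \<in> forms r d"
  by (simp add: forms_iff)

lemma forms_mult: "f \<in> forms r a \<Longrightarrow> g \<in> forms r b \<Longrightarrow> f * g \<in> forms r (a + b)"
  using keys_mult[of f g] monomials_add by (fastforce simp: forms_iff)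

abbreviation monomial_basis :: "nat \<Rightarrow> nat \<Rightarrow> 'k::field mpoly set" where
  "monomial_basis r d \<equiv> (\<lambda>m. Poly_Mapping.single m 1) ` monomials r d"

lemma span_monomial_basis: "mp.span (monomial_basis r d :: 'k::field mpoly set) = forms r d"
proof (rule mp.span_subspace[OF _ _ subspace_forms])
  show "monomial_basis r d \<subseteq> (forms r d :: 'k mpoly set)" by (auto simp: single_in_forms)
  show "forms r d \<subseteq> mp.span (monomial_basis r d :: 'k mpoly set)"
  proof
    fix f :: "'k mpoly" assume f: "f \<in> forms r d"
    have "(\<Sum>m\<in>Poly_Mapping.keys f. smul (Poly_Mapping.lookup f m) (Poly_Mapping.single m 1))
        \<in> mp.span (monomial_basis r d)"
      using f by (intro mp.span_sum mp.span_scale mp.span_base) (auto simp: forms_iff)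
    then show "f \<in> mp.span (monomial_basis r d)" by (simp only: mpoly_sum_monomials)
  qed
qed

lemma finite_monomial_basis: "finite (monomial_basis r d)"
  by (simp add: finite_monomials)

lemma inj_single_one: "inj (\<lambda>m. Poly_Mapping.single m (1 :: 'k::field))"
proof (rule injI)
  fix m n :: 'a assume "Poly_Mapping.single m (1 :: 'k) = Poly_Mapping.single n 1"
  then have "Poly_Mapping.keys (Poly_Mapping.single m (1 :: 'k)) = Poly_Mapping.keys (Poly_Mapping.single n (1 :: 'k))"
    by simp
  then show "m = n" by simp
qed

lemma independent_monomial_basis: "mp.independent (monomial_basis r d :: 'k::field mpoly set)"
proof -
  let ?s = "\<lambda>m. Poly_Mapping.single m 1 :: 'k mpoly"
  have inj: "inj ?s" by (rule inj_single_one)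
  show ?thesis
    unfolding mp.independent_explicit_finite_subsets
  proof (intro allI ballI impI)
    fix S :: "'k mpoly set" and u b assume S: "S \<subseteq> monomial_basis r d" "finite S" "(\<Sum>v\<in>S. smul (u v) v) = 0" and b: "b \<in> S"
    obtain M where M: "S = ?s ` M" using S(1) by (meson subset_imageE)
    obtain m where m: "m \<in> M" "b = ?s m" using b M by blast
    have fM: "finite M" using S(2) M inj by (metis finite_imageD inj_on_subset subset_UNIV)
    have "0 = Poly_Mapping.lookup (\<Sum>n\<in>M. smul (u (?s n)) (?s n)) m"
      using S(3) M inj by (simp add: sum.reindex inj_on_subset[of ?s UNIV])
    also have "\<dots> = u b"
      using m fM by (simp add: lookup_sum smul_single lookup_single) (simp add: when_def)
    finally show "u b = 0" by simp
  qed
qed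

lemma dim_forms: "mp.dim (forms r d :: 'k::field mpoly set) = card (monomials r d)"
proof -
  have "mp.dim (forms r d :: 'k mpoly set) = card (monomial_basis r d :: 'k mpoly set)"
    by (rule mp.dim_eq_card[OF _ independent_monomial_basis]) (metis span_monomial_basis mp.span_span)
  then show ?thesis by (simp add: card_image inj_on_subset[OF inj_single_one])
qed

section \<open>Homogeneous components\<close>

lemma lookup_hom_component:
  "Poly_Mapping.lookup (hom_component d f) m = (if mon_deg m = d then Poly_Mapping.lookup f m else 0)"
  unfolding hom_component_def
  by (auto simp: lookup_sum lookup_single when_def in_keys_iff)

lemma hom_component_in_forms: "f \<in> carrier (mpoly_ring r) \<Longrightarrow> hom_component d f \<in> forms r d"
  by (auto simp: forms_iff mpoly_ring_def monomials_def in_keys_iff lookup_hom_component split: if_splits)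

lemma hom_component_form: "f \<in> forms r d \<Longrightarrow> hom_component e f = (if e = d then f else 0)"
  by (rule poly_mapping_eqI) (auto simp: lookup_hom_component forms_iff monomials_def in_keys_iff)

lemma sum_hom_component:
  assumes "finite D" "mon_deg ` Poly_Mapping.keys f \<subseteq> D"
  shows "(\<Sum>d\<in>D. hom_component d f) = f"
proof (rule poly_mapping_eqI)
  fix m
  show "Poly_Mapping.lookup (\<Sum>d\<in>D. hom_component d f) m = Poly_Mapping.lookup f m"
    using assms by (cases "m \<in> Poly_Mapping.keys f")
     (auto simp: lookup_sum lookup_hom_component in_keys_iff)
qed

section \<open>Quotients by ideals\<close>

lemma mpoly_ring_minus:
  assumes "f \<in> carrier (mpoly_ring r)" "g \<in> carrier (mpoly_ring r)"
  shows "f \<ominus>\<^bsub>mpoly_ring r\<^esub> g = f - g"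
proof -
  interpret cring "mpoly_ring r :: 'a mpoly ring" by (rule cring_mpoly_ring)
  have "- g \<in> carrier (mpoly_ring r)"
    using mp.subspace_neg[OF subspace_carrier assms(2)] .
  then have "\<ominus>\<^bsub>mpoly_ring r\<^esub> g = - g"
    using assms(2) by (intro minus_equality) simp_all
  then show ?thesis by (simp add: a_minus_def)
qed

text \<open>Uniqueness of dimensions over \<open>scalars r I\<close> requires these to form a
  subfield of the quotient. The constants are a subfield upstairs, and a ring homomorphism to a
  nonzero ring carries subfields to subfields.\<close>

lemma subfield_scalars_mpoly_ring:
  "subfield (range (Poly_Mapping.single 0)) (mpoly_ring r :: 'k::field mpoly ring)"
proof -
  interpret R: cring "mpoly_ring r :: 'k mpoly ring" by (rule cring_mpoly_ring)
  let ?K = "range (Poly_Mapping.single 0) :: 'k mpoly set"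
  have K: "?K \<subseteq> carrier (mpoly_ring r)" by (auto simp: single_in_carrier)
  show ?thesis
  proof (rule R.subfieldI[OF R.subcringI'[OF R.subringI]])
    show "?K \<subseteq> carrier (mpoly_ring r)" by (rule K)
    show "\<one>\<^bsub>mpoly_ring r\<^esub> \<in> ?K" by (auto simp: image_iff intro!: exI[of _ 1])
    show "\<ominus>\<^bsub>mpoly_ring r\<^esub> h \<in> ?K" if h: "h \<in> ?K" for h
    proof -
      have "\<ominus>\<^bsub>mpoly_ring r\<^esub> h = \<zero>\<^bsub>mpoly_ring r\<^esub> \<ominus>\<^bsub>mpoly_ring r\<^esub> h"
        using h K by (auto simp: R.minus_eq)
      also have "\<dots> = - h" using h K mpoly_ring_minus[of 0 r h] R.zero_closed by auto
      finally show ?thesis using h by (auto simp: single_uminus[symmetric])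
    qed
    show "g \<otimes>\<^bsub>mpoly_ring r\<^esub> h \<in> ?K" if "g \<in> ?K" "h \<in> ?K" for g h
      using that by (auto simp: mult_single)
    show "g \<oplus>\<^bsub>mpoly_ring r\<^esub> h \<in> ?K" if "g \<in> ?K" "h \<in> ?K" for g h
      using that by (auto simp: single_add[symmetric])
    show "Units (mpoly_ring r\<lparr>carrier := ?K\<rparr>) = ?K - {\<zero>\<^bsub>mpoly_ring r\<^esub>}"
    proof (intro equalityI subsetI)
      fix x assume "x \<in> Units (mpoly_ring r\<lparr>carrier := ?K\<rparr>)"
      then obtain y where "x \<in> ?K" "y * x = 1"
        by (auto simp: Units_def mpoly_ring_def)
      then show "x \<in> ?K - {\<zero>\<^bsub>mpoly_ring r\<^esub>}" by auto
    next
      fix x assume x: "x \<in> ?K - {\<zero>\<^bsub>mpoly_ring r\<^esub>}"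
      then obtain c where c: "x = Poly_Mapping.single 0 c" by auto
      then have "c \<noteq> 0" using x by auto
      then have "Poly_Mapping.single 0 (inverse c) * x = 1" "x * Poly_Mapping.single 0 (inverse c) = 1"
        unfolding c by (simp_all add: mult_single)
      then show "x \<in> Units (mpoly_ring r\<lparr>carrier := ?K\<rparr>)"
        using x by (auto simp: Units_def mpoly_ring_def)
    qed
  qed
qed

section \<open>The quotient A = R/I: cosets, dimensions, socle and chains of ideals\<close>

locale mpoly_ideal = ideal I "mpoly_ring r" for r and I :: "'k::field mpoly set"
begin

abbreviation cls :: "'k mpoly \<Rightarrow> 'k mpoly set" where
  "cls f \<equiv> I +>\<^bsub>mpoly_ring r\<^esub> f"

sublocale quot: ring_hom_ring "mpoly_ring r" "mpoly_ring r Quot I" cls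
  by (rule rcos_ring_hom_ring)

lemma cls_eq_iff:
  "f \<in> carrier (mpoly_ring r) \<Longrightarrow> g \<in> carrier (mpoly_ring r) \<Longrightarrow> cls f = cls g \<longleftrightarrow> f - g \<in> I"
  using quotient_eq_iff_same_a_r_cos[OF ideal_axioms, of f g] by (simp add: mpoly_ring_minus)

lemma cls_mult: "f \<in> carrier (mpoly_ring r) \<Longrightarrow> g \<in> carrier (mpoly_ring r) \<Longrightarrow>
    cls f \<otimes>\<^bsub>mpoly_ring r Quot I\<^esub> cls g = cls (f * g)"
  using quot.hom_mult[of f g] by simp

lemma cls_add: "f \<in> carrier (mpoly_ring r) \<Longrightarrow> g \<in> carrier (mpoly_ring r) \<Longrightarrow>
    cls f \<oplus>\<^bsub>mpoly_ring r Quot I\<^esub> cls g = cls (f + g)"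
  using quot.hom_add[of f g] by simp

lemma zero_in_I [simp]: "0 \<in> I"
  using additive_subgroup.zero_closed[OF is_additive_subgroup] by simp

lemma zero_in_carrier [simp]: "0 \<in> carrier (mpoly_ring r)"
  by (simp add: mpoly_ring_def)

lemma cls_eq_zero_iff:
  "f \<in> carrier (mpoly_ring r) \<Longrightarrow> cls f = \<zero>\<^bsub>mpoly_ring r Quot I\<^esub> \<longleftrightarrow> f \<in> I"
  using cls_eq_iff[of f 0] quot.hom_zero by simp

lemma carrier_Quot: "carrier (mpoly_ring r Quot I) = cls ` carrier (mpoly_ring r)"
  by (auto simp: FactRing_def A_RCOSETS_def' )

lemma I_mult: "f \<in> I \<Longrightarrow> g \<in> carrier (mpoly_ring r) \<Longrightarrow> f * g \<in> I"
  using I_r_closed by simp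

lemma subspace_I: "mp.subspace I"
  unfolding mp.subspace_def
proof (intro conjI ballI allI)
  show "0 \<in> I" by simp
  show "f + g \<in> I" if "f \<in> I" "g \<in> I" for f g
    using additive_subgroup.a_closed[OF is_additive_subgroup that] by simp
  show "smul c f \<in> I" if "f \<in> I" for c f
    using I_mult[OF that, of "Poly_Mapping.single 0 c"] by (simp add: single_in_carrier smul_def mult.commute)
qed

text \<open>The predicate \<open>dimension\<close> grows a space by one line at a time. Each such
  step downstairs is the image of adjoining one vector to a span upstairs.\<close>

lemma line_extension_quot_image:
  assumes V: "mp.subspace V" "V \<subseteq> carrier (mpoly_ring r)" and b: "b \<in> carrier (mpoly_ring r)"
  shows "Embedded_Algebras.ring.line_extension (mpoly_ring r Quot I) (scalars r I) (cls b) (quot_image r I V)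
    = quot_image r I (mp.span (insert b V))"
proof -
  have eq: "cls (Poly_Mapping.single 0 c) \<otimes>\<^bsub>mpoly_ring r Quot I\<^esub> cls b \<oplus>\<^bsub>mpoly_ring r Quot I\<^esub> cls v = cls (smul c b + v)"
    if "v \<in> V" for c v
  proof -
    have "smul c b \<in> carrier (mpoly_ring r)" using mp.subspace_scale[OF subspace_carrier b] .
    then show ?thesis
      using that V b by (simp add: cls_mult single_in_carrier cls_add subset_iff flip: smul_def)
  qed
  have span: "x \<in> mp.span (insert b V) \<longleftrightarrow> (\<exists>c. \<exists>v\<in>V. x = smul c b + v)" for x
    using V(1) by (simp add: mp.span_breakdown_eq mp.span_eq_iff[THEN iffD2]) (metis add_diff_cancel_left' diff_add_cancel add.commute)
  show ?thesis
  proof (intro equalityI subsetI)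
    fix u assume "u \<in> quot.S.line_extension (scalars r I) (cls b) (quot_image r I V)"
    then obtain c v where "v \<in> V" "u = cls (smul c b + v)"
      using eq by (auto simp: quot.S.line_extension_mem_iff scalars_def quot_image_def)
    then show "u \<in> quot_image r I (mp.span (insert b V))"
      unfolding quot_image_def using span by blast
  next
    fix u assume "u \<in> quot_image r I (mp.span (insert b V))"
    then obtain x where x: "x \<in> mp.span (insert b V)" "u = cls x"
      unfolding quot_image_def by blast
    obtain c v where cv: "v \<in> V" "x = smul c b + v"
      using iffD1[OF span x(1)] by blast
    have "u = cls (Poly_Mapping.single 0 c) \<otimes>\<^bsub>mpoly_ring r Quot I\<^esub> cls b \<oplus>\<^bsub>mpoly_ring r Quot I\<^esub> cls v"
      "cls v \<in> quot_image r I V" "cls (Poly_Mapping.single 0 c) \<in> scalars r I"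
      using eq[OF cv(1)] cv x(2) by (auto simp: scalars_def quot_image_def)
    then show "u \<in> quot.S.line_extension (scalars r I) (cls b) (quot_image r I V)"
      unfolding quot.S.line_extension_mem_iff by blast
  qed
qed

lemma quot_image_zero: "quot_image r I {0} = {\<zero>\<^bsub>mpoly_ring r Quot I\<^esub>}"
  using cls_eq_zero_iff[of 0] by (simp add: quot_image_def)

text \<open>Since the span meets \<open>I\<close> only in 0, the projection is injective on it. A
  new basis vector therefore has a class outside the image of the previous span, which is the side
  condition for adding a line.\<close>

lemma has_kdim_span:
  assumes "finite B" "mp.independent B" "B \<subseteq> carrier (mpoly_ring r)" "mp.span B \<inter> I = {0}"
  shows "has_kdim r I (quot_image r I (mp.span B)) (card B)"
  using assms
proof (induction B)
  case empty
  then show ?case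
    unfolding has_kdim_def by (simp add: quot_image_zero quot.S.dimension.zero_dim)
next
  case (insert b B)
  have ind: "mp.independent B" "b \<notin> mp.span B"
    using insert.prems(1) insert.hyps by (auto simp: mp.independent_insert)
  have sub: "mp.span B \<subseteq> mp.span (insert b B)" by (rule mp.span_mono) blast
  have B: "mp.span B \<subseteq> carrier (mpoly_ring r)"
    using insert.prems(2) by (intro mp.span_minimal subspace_carrier) auto
  have b: "b \<in> carrier (mpoly_ring r)" using insert.prems by simp
  have "mp.span B \<inter> I = {0}" using insert.prems(3) sub mp.span_zero[of B] by auto
  then have IH: "has_kdim r I (quot_image r I (mp.span B)) (card B)"
    using insert.IH ind insert.prems by simp
  have "cls b \<notin> quot_image r I (mp.span B)"
  proof
    assume "cls b \<in> quot_image r I (mp.span B)"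
    then obtain v where v: "v \<in> mp.span B" "cls b = cls v" by (auto simp: quot_image_def)
    then have "b - v \<in> I" using cls_eq_iff[OF b] B by auto
    moreover have "b - v \<in> mp.span (insert b B)"
      using v(1) sub by (intro mp.span_diff) (auto intro: mp.span_base)
    ultimately have "b - v = 0" using insert.prems(3) by blast
    then have "b = v" by simp
    then show False using v ind by simp
  qed
  then have "has_kdim r I (Embedded_Algebras.ring.line_extension (mpoly_ring r Quot I) (scalars r I) (cls b)
      (quot_image r I (mp.span B))) (Suc (card B))"
    using IH quot.hom_closed[OF b] unfolding has_kdim_def by (intro quot.S.dimension.Suc_dim)
  moreover have "mp.span (insert b (mp.span B)) = mp.span (insert b B)"
    by (simp add: mp.span_insert mp.span_span)
  ultimately show ?case
    using insert.hyps by (simp add: line_extension_quot_image[OF mp.subspace_span B b])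
qed

text \<open>The image of \<open>V\<close> equals the image of a complement of
  \<open>V \<inter> I\<close> in \<open>V\<close>, and the projection is injective on that
  complement.\<close>

lemma has_kdim_quot_image:
  assumes V: "mp.subspace V" "V \<subseteq> carrier (mpoly_ring r)" "V \<subseteq> mp.span T" "finite T"
    and n: "mp.dim V = n + mp.dim (V \<inter> I)"
  shows "has_kdim r I (quot_image r I V) n"
proof -
  obtain C where C: "finite C" "C \<subseteq> V" "mp.independent C" "mp.span C \<inter> (V \<inter> I) = {0}"
    "card C + mp.dim (V \<inter> I) = mp.dim V" "\<And>v. v \<in> V \<Longrightarrow> \<exists>c\<in>mp.span C. v - c \<in> V \<inter> I"
    using mp.subspace_complement_finite[OF mp.subspace_inter[OF V(1) subspace_I] V(1) _ V(3,4)] by blast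
  have sp: "mp.span C \<subseteq> V" using C(2) V(1) by (rule mp.span_minimal)
  have "quot_image r I V = quot_image r I (mp.span C)"
  proof
    show "quot_image r I V \<subseteq> quot_image r I (mp.span C)"
    proof
      fix x assume "x \<in> quot_image r I V"
      then obtain v where v: "v \<in> V" "x = cls v" by (auto simp: quot_image_def)
      obtain c where c: "c \<in> mp.span C" "v - c \<in> I" using C(6)[OF v(1)] by blast
      then have "x = cls c" using v cls_eq_iff[of v c] V(2) sp by auto
      then show "x \<in> quot_image r I (mp.span C)" using c by (auto simp: quot_image_def)
    qed
  qed (use sp in \<open>auto simp: quot_image_def\<close>)
  moreover have "mp.span C \<inter> I = {0}" using C(4) sp by blast
  ultimately show ?thesis
    using has_kdim_span[OF C(1,3)] C(2,5) V(2) n by simp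
qed

lemma subfield_scalars:
  assumes "1 \<notin> I"
  shows "subfield (scalars r I) (mpoly_ring r Quot I)"
proof -
  have "cls 1 \<noteq> \<zero>\<^bsub>mpoly_ring r Quot I\<^esub>"
    using cls_eq_zero_iff[of 1] assms one_closed by simp
  then have "\<one>\<^bsub>mpoly_ring r Quot I\<^esub> \<noteq> \<zero>\<^bsub>mpoly_ring r Quot I\<^esub>"
    using quot.hom_one by simp
  then show ?thesis
    unfolding scalars_def quot_image_def
    by (rule quot.img_is_subfield(2)[OF subfield_scalars_mpoly_ring])
qed

lemma has_kdim_unique:
  "1 \<notin> I \<Longrightarrow> has_kdim r I V m \<Longrightarrow> has_kdim r I V n \<Longrightarrow> m = n"
  unfolding has_kdim_def by (rule quot.S.dimension_is_inj[OF subfield_scalars])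

lemma has_kdim_quot_image_iff:
  assumes V: "mp.subspace V" "V \<subseteq> carrier (mpoly_ring r)" "V \<subseteq> mp.span T" "finite T"
    and I: "1 \<notin> I"
  shows "has_kdim r I (quot_image r I V) n \<longleftrightarrow> mp.dim V = n + mp.dim (V \<inter> I)"
proof -
  have le: "mp.dim (V \<inter> I) \<le> mp.dim V"
    using mp.dim_mono_finite[OF _ V(3,4)] by blast
  then have k: "has_kdim r I (quot_image r I V) (mp.dim V - mp.dim (V \<inter> I))"
    by (intro has_kdim_quot_image[OF V]) simp
  show ?thesis
  proof
    assume "has_kdim r I (quot_image r I V) n"
    from has_kdim_unique[OF I this k] le show "mp.dim V = n + mp.dim (V \<inter> I)" by simp
  qed (rule has_kdim_quot_image[OF V])
qed

lemma has_kdim_graded_piece_iff: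
  "1 \<notin> I \<Longrightarrow> has_kdim r I (graded_piece r I d) n \<longleftrightarrow> mp.dim (forms r d :: 'k mpoly set) = n + mp.dim (forms r d \<inter> I)"
  unfolding graded_piece_def
  by (rule has_kdim_quot_image_iff[OF subspace_forms forms_subset_carrier _ finite_monomial_basis[of r d]])
    (simp add: span_monomial_basis)

text \<open>In the zero ring a line can never be added, because the new vector would have to lie
  outside a space that already contains 0. Only dimension 0 is then derivable.\<close>

lemma proper_of_has_kdim:
  assumes "has_kdim r I V n" "n > 0"
  shows "1 \<notin> I"
proof
  assume one: "1 \<in> I"
  have "cls f = \<zero>\<^bsub>mpoly_ring r Quot I\<^esub>" if "f \<in> carrier (mpoly_ring r)" for f
    using I_mult[OF one that] cls_eq_zero_iff[OF that] by simp
  then have triv: "carrier (mpoly_ring r Quot I) \<subseteq> {\<zero>\<^bsub>mpoly_ring r Quot I\<^esub>}"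
    by (auto simp: carrier_Quot)
  have "V = {\<zero>\<^bsub>mpoly_ring r Quot I\<^esub>} \<and> n = 0"
    if "quot.S.dimension n (scalars r I) V" for n V
    using that
  proof (induction)
    case zero_dim
    then show ?case by simp
  next
    case (Suc_dim v E n)
    then show ?case using triv by auto
  qed
  then show False using assms unfolding has_kdim_def by blast
qed

lemma socle_iff:
  assumes f: "f \<in> carrier (mpoly_ring r)"
  shows "cls f \<in> socle r I \<longleftrightarrow> (\<forall>g\<in>carrier (mpoly_ring r). Poly_Mapping.lookup g 0 = 0 \<longrightarrow> f * g \<in> I)"
proof -
  have "cls f \<otimes>\<^bsub>mpoly_ring r Quot I\<^esub> cls g = \<zero>\<^bsub>mpoly_ring r Quot I\<^esub> \<longleftrightarrow> f * g \<in> I"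
    if "g \<in> carrier (mpoly_ring r)" for g
    using f that cls_eq_zero_iff[OF carrier_mult[OF f that]] by (simp add: cls_mult)
  then show ?thesis
    using quot.hom_closed[OF f] by (auto simp: socle_def hom_max_ideal_def quot_image_def)
qed

text \<open>Every class has a representative of degree at most \<open>e\<close>, and these
  polynomials form a finite-dimensional space \<open>E\<close>. A descending chain of ideals is thus
  governed by the descending chain of subspaces \<open>D n\<close> of \<open>E\<close>.\<close>

lemma artinian_quot:
  assumes e: "\<And>d. d > e \<Longrightarrow> forms r d \<subseteq> I"
  shows "artinian_ring (mpoly_ring r Quot I)"
  unfolding artinian_ring_def
proof (intro conjI allI impI)
  show "ring (mpoly_ring r Quot I)" by (rule quotient_is_ring)
next
  fix J :: "nat \<Rightarrow> 'k mpoly set set"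
  assume J: "\<forall>n. ideal (J n) (mpoly_ring r Quot I) \<and> J (Suc n) \<subseteq> J n"
  then have id: "ideal (J n) (mpoly_ring r Quot I)" for n by blast
  have anti: "J n \<subseteq> J N" if "N \<le> n" for N n
    using lift_Suc_antimono_le[of J, OF _ that] J by blast
  define M where "M = (\<Union>d\<le>e. monomials r d)"
  define E :: "'k mpoly set" where "E = {f. Poly_Mapping.keys f \<subseteq> M}"
  have M: "finite M" by (simp add: M_def finite_monomials)
  have EC: "E \<subseteq> carrier (mpoly_ring r)" by (auto simp: E_def M_def mpoly_ring_def monomials_def)
  have ES: "E \<subseteq> mp.span ((\<lambda>m. Poly_Mapping.single m 1) ` M)"
  proof
    fix f assume "f \<in> E"
    then have "(\<Sum>m\<in>Poly_Mapping.keys f. smul (Poly_Mapping.lookup f m) (Poly_Mapping.single m 1))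
        \<in> mp.span ((\<lambda>m. Poly_Mapping.single m 1) ` M)"
      by (intro mp.span_sum mp.span_scale mp.span_base) (auto simp: E_def)
    then show "f \<in> mp.span ((\<lambda>m. Poly_Mapping.single m 1) ` M)" by (simp only: mpoly_sum_monomials)
  qed
  define D where "D n = {f \<in> E. cls f \<in> J n}" for n
  have D: "mp.subspace (D n)" for n
    unfolding mp.subspace_def
  proof (intro conjI ballI allI)
    have "cls 0 \<in> J n"
      using additive_subgroup.zero_closed[OF ideal.axioms(1)[OF id]] cls_eq_zero_iff[of 0] by simp
    then show "0 \<in> D n" by (simp add: D_def E_def)
    show "f + g \<in> D n" if fg: "f \<in> D n" "g \<in> D n" for f g
    proof -
      have "f \<in> carrier (mpoly_ring r)" "g \<in> carrier (mpoly_ring r)" using fg EC by (auto simp: D_def)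
      then have "cls (f + g) \<in> J n"
        using additive_subgroup.a_closed[OF ideal.axioms(1)[OF id], of "cls f" n "cls g"] fg
        by (simp add: D_def cls_add)
      then show ?thesis using fg keys_add[of f g] by (auto simp: D_def E_def)
    qed
    show "smul c f \<in> D n" if f: "f \<in> D n" for c f
    proof -
      have "f \<in> carrier (mpoly_ring r)" using f EC by (auto simp: D_def)
      then have "cls (smul c f) \<in> J n"
        using ideal.I_l_closed[OF id, of "cls f" n "cls (Poly_Mapping.single 0 c)"] f
        by (simp add: D_def cls_mult single_in_carrier smul_def)
      then show ?thesis using f by (auto simp: D_def E_def in_keys_iff lookup_smul)
    qed
  qed
  \<comment> \<open>An index of least dimension: for later \<open>n\<close> the space
    \<open>D n\<close> lies in \<open>D N\<close> and is no smaller, so the two coincide.\<close>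
  obtain N where N: "\<And>n. mp.dim (D N) \<le> mp.dim (D n)"
    using ex_has_least_nat[of "\<lambda>_. True" 0 "\<lambda>n. mp.dim (D n)"] by blast
  have "J n = J N" if n: "N \<le> n" for n
  proof
    show "J n \<subseteq> J N" by (rule anti[OF n])
    show "J N \<subseteq> J n"
    proof
      fix x assume x: "x \<in> J N"
      then have "x \<in> carrier (mpoly_ring r Quot I)"
        using additive_subgroup.a_subset[OF ideal.axioms(1)[OF id]] by blast
      then obtain f where f: "f \<in> carrier (mpoly_ring r)" "x = cls f" by (auto simp: carrier_Quot)
      \<comment> \<open>Truncating \<open>f\<close> drops only components of degree above
        \<open>e\<close>, all of which lie in \<open>I\<close>.\<close>
      define f' where "f' = (\<Sum>d\<le>e. hom_component d f)"
      have f': "f' \<in> E"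
        using f(1) by (auto simp: f'_def E_def M_def in_keys_iff lookup_sum lookup_hom_component
            monomials_def mpoly_ring_def split: if_splits dest!: sum.not_neutral_contains_not_neutral)
      let ?D = "{..e} \<union> mon_deg ` Poly_Mapping.keys f"
      have "(\<Sum>d\<in>?D. hom_component d f) = f" by (rule sum_hom_component) auto
      moreover have "(\<Sum>d\<in>?D. hom_component d f) = f' + (\<Sum>d\<in>?D - {..e}. hom_component d f)"
        unfolding f'_def by (rule sum.subset_diff[THEN trans]) (auto simp: add.commute)
      moreover have "(\<Sum>d\<in>?D - {..e}. hom_component d f) \<in> I"
        using e hom_component_in_forms[OF f(1)] by (intro mp.subspace_sum[OF subspace_I]) (auto simp: not_le)
      ultimately have "f - f' \<in> I" by (metis add_diff_cancel_left')
      then have xf': "x = cls f'" using cls_eq_iff[of f f'] f f' EC by auto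
      then have "f' \<in> D N" using x f' by (simp add: D_def)
      moreover have "D n = D N"
        by (rule mp.subspace_eq_of_dim_le[OF D _ _ _ N])
          (use anti[OF n] ES M in \<open>auto simp: D_def\<close>)
      ultimately show "x \<in> J n" using xf' by (auto simp: D_def)
    qed
  qed
  then show "\<exists>N. \<forall>n\<ge>N. J n = J N" by blast
qed

end

section \<open>The annihilator of a linear functional\<close>

text \<open>The largest ideal of the ring contained in the kernel of the functional
  \<open>coeff_sum w\<close>. Testing against all \<open>g\<close>, not only those of complementary
  degree, makes the ideal property immediate; homogeneity is derived separately.\<close>

definition apolar :: "nat \<Rightarrow> ((nat \<Rightarrow>\<^sub>0 nat) \<Rightarrow> 'k) \<Rightarrow> 'k::field mpoly set" where
  "apolar r w = {f \<in> carrier (mpoly_ring r). \<forall>g \<in> carrier (mpoly_ring r). coeff_sum w (f * g) = 0}"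

text \<open>A functional on the forms of degree \<open>e\<close>, extended by zero to the other
  degrees. It plays the part of the dual form of degree \<open>e\<close>.\<close>

definition homogeneous_weight :: "nat \<Rightarrow> ((nat \<Rightarrow>\<^sub>0 nat) \<Rightarrow> 'k::zero) \<Rightarrow> bool" where
  "homogeneous_weight e w \<longleftrightarrow> (\<forall>m. mon_deg m \<noteq> e \<longrightarrow> w m = 0)"

lemma ideal_apolar: "ideal (apolar r w) (mpoly_ring r :: 'k::field mpoly ring)"
proof -
  interpret R: cring "mpoly_ring r :: 'k mpoly ring" by (rule cring_mpoly_ring)
  have mult: "f * g \<in> apolar r w" if "f \<in> apolar r w" "g \<in> carrier (mpoly_ring r)" for f g
    using that by (auto simp: apolar_def carrier_mult mult.assoc)
  have neg: "\<ominus>\<^bsub>mpoly_ring r\<^esub> f = - f" if "f \<in> carrier (mpoly_ring r)" for f :: "'k mpoly"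
    using that mp.subspace_neg[OF subspace_carrier that] by (intro R.minus_equality) simp_all
  show ?thesis
  proof (rule idealI)
    show "ring (mpoly_ring r :: 'k mpoly ring)" by (rule R.ring_axioms)
    show "subgroup (apolar r w) (add_monoid (mpoly_ring r))"
    proof (rule R.add.subgroupI)
      show "apolar r w \<subseteq> carrier (mpoly_ring r)" by (auto simp: apolar_def)
      have "0 \<in> apolar r w" using R.zero_closed by (simp add: apolar_def)
      then show "apolar r w \<noteq> {}" by blast
      show "\<ominus>\<^bsub>mpoly_ring r\<^esub> f \<in> apolar r w" if "f \<in> apolar r w" for f
      proof -
        have "- 1 \<in> carrier (mpoly_ring r :: 'k mpoly ring)"
          using mp.subspace_neg[OF subspace_carrier] R.one_closed by simp
        then show ?thesis using mult[OF that, of "- 1"] neg[of f] that by (simp add: apolar_def)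
      qed
      show "f \<oplus>\<^bsub>mpoly_ring r\<^esub> g \<in> apolar r w" if "f \<in> apolar r w" "g \<in> apolar r w" for f g
        using that mp.subspace_add[OF subspace_carrier, of f r g]
        by (auto simp: apolar_def distrib_right coeff_sum_add)
    qed
    show "g \<otimes>\<^bsub>mpoly_ring r\<^esub> f \<in> apolar r w" if "f \<in> apolar r w" "g \<in> carrier (mpoly_ring r)" for f g
      using mult[OF that] by (simp add: mult.commute)
    show "f \<otimes>\<^bsub>mpoly_ring r\<^esub> g \<in> apolar r w" if "f \<in> apolar r w" "g \<in> carrier (mpoly_ring r)" for f g
      using mult[OF that] by simp
  qed
qed

lemma mpoly_ideal_apolar: "mpoly_ideal r (apolar r w)"
  unfolding mpoly_ideal_def by (rule ideal_apolar)

lemma coeff_sum_form_degree_neq: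
  "homogeneous_weight e w \<Longrightarrow> f \<in> forms r d \<Longrightarrow> d \<noteq> e \<Longrightarrow> coeff_sum w f = 0"
  unfolding coeff_sum_def by (intro sum.neutral) (auto simp: forms_iff monomials_def homogeneous_weight_def)

lemma coeff_sum_eq_hom_component:
  assumes "homogeneous_weight e w" "f \<in> carrier (mpoly_ring r)"
  shows "coeff_sum w f = coeff_sum w (hom_component e f)"
proof -
  let ?D = "insert e (mon_deg ` Poly_Mapping.keys f)"
  have "coeff_sum w f = coeff_sum w (\<Sum>d\<in>?D. hom_component d f)"
    by (subst sum_hom_component) auto
  also have "\<dots> = (\<Sum>d\<in>?D. coeff_sum w (hom_component d f))" by (rule coeff_sum_sum)
  also have "\<dots> = (\<Sum>d\<in>{e}. coeff_sum w (hom_component d f))"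
    using coeff_sum_form_degree_neq[OF assms(1) hom_component_in_forms[OF assms(2)]]
    by (intro sum.mono_neutral_right) auto
  finally show ?thesis by simp
qed

lemma hom_component_sum: "hom_component d (\<Sum>x\<in>A. f x) = (\<Sum>x\<in>A. hom_component d (f x))"
  by (rule poly_mapping_eqI) (simp add: lookup_hom_component lookup_sum)

lemma hom_component_mult_form:
  assumes f: "f \<in> forms r d" and g: "g \<in> carrier (mpoly_ring r)"
  shows "hom_component (d + j) (f * g) = f * hom_component j g"
proof -
  let ?D = "insert j (mon_deg ` Poly_Mapping.keys g)"
  have "f * g = f * (\<Sum>i\<in>?D. hom_component i g)"
    by (subst sum_hom_component) auto
  then have "hom_component (d + j) (f * g) = (\<Sum>i\<in>?D. hom_component (d + j) (f * hom_component i g))"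
    by (simp only: sum_distrib_left hom_component_sum)
  also have "\<dots> = (\<Sum>i\<in>?D. if i = j then f * hom_component j g else 0)"
    by (intro sum.cong refl) (auto simp: hom_component_form[OF forms_mult[OF f hom_component_in_forms[OF g]]])
  finally show ?thesis by simp
qed

text \<open>Only the component of \<open>g\<close> of degree \<open>j\<close> contributes to the
  value on \<open>f * g\<close>. Degree \<open>d\<close> of the ideal is therefore the radical of
  the pairing between degrees \<open>d\<close> and \<open>j\<close>.\<close>

lemma apolar_form_iff:
  assumes w: "homogeneous_weight (d + j) w" and f: "f \<in> forms r d"
  shows "f \<in> apolar r w \<longleftrightarrow> (\<forall>g\<in>forms r j. coeff_sum w (f * g) = 0)"
proof
  show "f \<in> apolar r w \<Longrightarrow> \<forall>g\<in>forms r j. coeff_sum w (f * g) = 0"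
    using forms_subset_carrier by (auto simp: apolar_def)
next
  assume *: "\<forall>g\<in>forms r j. coeff_sum w (f * g) = 0"
  have fc: "f \<in> carrier (mpoly_ring r)" using f forms_subset_carrier by blast
  show "f \<in> apolar r w"
    unfolding apolar_def
  proof (intro CollectI conjI ballI fc)
    fix g :: "'a mpoly" assume g: "g \<in> carrier (mpoly_ring r)"
    have "coeff_sum w (f * g) = coeff_sum w (f * hom_component j g)"
      using coeff_sum_eq_hom_component[OF w carrier_mult[OF fc g]] hom_component_mult_form[OF f g] by simp
    then show "coeff_sum w (f * g) = 0" using * hom_component_in_forms[OF g] by simp
  qed
qed

lemma forms_subset_apolar:
  assumes w: "homogeneous_weight e w" and d: "d > e"
  shows "forms r d \<subseteq> apolar r w"
proof
  fix f :: "'a mpoly" assume f: "f \<in> forms r d"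
  then have fc: "f \<in> carrier (mpoly_ring r)" using forms_subset_carrier by blast
  show "f \<in> apolar r w"
    unfolding apolar_def
  proof (intro CollectI conjI ballI fc)
    fix g :: "'a mpoly" assume g: "g \<in> carrier (mpoly_ring r)"
    have "Poly_Mapping.lookup (f * g) m = 0" if "mon_deg m = e" for m
    proof -
      have "m \<notin> Poly_Mapping.keys (f * g)"
        using keys_mult[of f g] f d that by (fastforce simp: forms_iff monomials_def mon_deg_add)
      then show ?thesis by (simp add: in_keys_iff)
    qed
    then have "hom_component e (f * g) = 0"
      by (intro poly_mapping_eqI) (simp add: lookup_hom_component)
    then show "coeff_sum w (f * g) = 0"
      using coeff_sum_eq_hom_component[OF w carrier_mult[OF fc g]] by simp
  qed
qed

lemma coeff_sum_mult_form_component: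
  assumes w: "homogeneous_weight (d + j) w" and f: "f \<in> carrier (mpoly_ring r)" and g: "g \<in> forms r j"
  shows "coeff_sum w (hom_component d f * g) = coeff_sum w (f * g)"
proof -
  have gc: "g \<in> carrier (mpoly_ring r)" using g forms_subset_carrier by blast
  show ?thesis
    using coeff_sum_eq_hom_component[OF w carrier_mult[OF f gc]] hom_component_mult_form[OF g f, of d]
    by (simp add: mult.commute add.commute)
qed

lemma homogeneous_ideal_apolar:
  assumes w: "homogeneous_weight e w"
  shows "homogeneous_ideal r (apolar r w)"
  unfolding homogeneous_ideal_def
proof (intro conjI ballI allI ideal_apolar)
  fix f d assume f: "f \<in> apolar r w"
  then have fc: "f \<in> carrier (mpoly_ring r)" by (simp add: apolar_def)
  show "hom_component d f \<in> apolar r w"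
  proof (cases "d \<le> e")
    case True
    then have w': "homogeneous_weight (d + (e - d)) w" using w by simp
    have "coeff_sum w (hom_component d f * g) = 0" if "g \<in> forms r (e - d)" for g
      using coeff_sum_mult_form_component[OF w' fc that] f that forms_subset_carrier
      by (auto simp: apolar_def)
    then show ?thesis
      using apolar_form_iff[OF w' hom_component_in_forms[OF fc]] by blast
  next
    case False
    then show ?thesis using forms_subset_apolar[OF w] hom_component_in_forms[OF fc] by (meson not_le subsetD)
  qed
qed

lemma coeff_sum_mult_forms_eq_0:
  assumes "\<And>m. m \<in> monomials r d \<Longrightarrow> coeff_sum w (f * Poly_Mapping.single m 1) = 0" "g \<in> forms r d"
  shows "coeff_sum w (f * g) = 0"
proof -
  have "coeff_sum w (f * g) = coeff_sum w (f * (\<Sum>m\<in>Poly_Mapping.keys g.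
      smul (Poly_Mapping.lookup g m) (Poly_Mapping.single m 1)))"
    by (simp only: mpoly_sum_monomials)
  also have "\<dots> = (\<Sum>m\<in>Poly_Mapping.keys g. Poly_Mapping.lookup g m * coeff_sum w (f * Poly_Mapping.single m 1))"
    by (simp add: sum_distrib_left coeff_sum_sum smul_mult_right coeff_sum_smul)
  also have "\<dots> = 0"
    using assms by (intro sum.neutral) (auto simp: forms_iff)
  finally show ?thesis .
qed

text \<open>A monomial of degree \<open>b + c\<close> splits as \<open>p + q\<close> with
  \<open>p\<close> of degree \<open>b\<close>, and the functional vanishes on the product of
  \<open>f\<close> with both parts because \<open>f\<close> times the first part is already in the
  ideal.\<close>

lemma apolar_of_mult_forms:
  assumes w: "homogeneous_weight (a + b + c) w" and f: "f \<in> forms r a"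
    and fg: "\<And>g. g \<in> forms r b \<Longrightarrow> f * g \<in> apolar r w"
  shows "f \<in> apolar r w"
proof -
  have "coeff_sum w (f * Poly_Mapping.single m 1) = 0" if m: "m \<in> monomials r (b + c)" for m
  proof -
    obtain p q where pq: "p \<in> monomials r b" "q \<in> monomials r c" "m = p + q"
      using monomials_factor[OF m] by blast
    have "f * Poly_Mapping.single p 1 \<in> apolar r w"
      using fg single_in_forms[OF pq(1)] by blast
    moreover have "(Poly_Mapping.single q 1 :: 'a mpoly) \<in> carrier (mpoly_ring r)"
      using pq(2) by (intro single_in_carrier) (simp add: monomials_def)
    ultimately have "coeff_sum w (f * Poly_Mapping.single p 1 * Poly_Mapping.single q 1) = 0"
      by (simp add: apolar_def)
    then show ?thesis by (simp add: pq(3) mult_single mult.assoc)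
  qed
  then show ?thesis
    using apolar_form_iff[OF _ f, of "b + c" w] w coeff_sum_mult_forms_eq_0[of r "b + c" w f]
    by (auto simp: add.assoc)
qed

lemma forms_subset_span: "forms r d \<subseteq> mp.span (monomial_basis r d)"
  by (simp add: span_monomial_basis)

text \<open>The two radicals of the pairing between degrees \<open>d\<close> and \<open>j\<close>
  are the graded pieces of the ideal, so equality of ranks is the symmetry of the h-vector.\<close>

lemma dim_forms_apolar_symmetric:
  fixes w :: "(nat \<Rightarrow>\<^sub>0 nat) \<Rightarrow> 'k::field"
  assumes w: "homogeneous_weight (d + j) w"
  shows "mp.dim (forms r j :: 'k mpoly set) + mp.dim (forms r d \<inter> apolar r w)
    = mp.dim (forms r d :: 'k mpoly set) + mp.dim (forms r j \<inter> apolar r w)"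
proof -
  have "{f \<in> forms r d. \<forall>g\<in>forms r j. coeff_sum w (f * g) = 0} = forms r d \<inter> apolar r w"
    using apolar_form_iff[OF w] by blast
  moreover have "{g \<in> forms r j. \<forall>f\<in>forms r d. coeff_sum w (f * g) = 0} = forms r j \<inter> apolar r w"
    using apolar_form_iff[of j d w] w by (auto simp: add.commute mult.commute)
  ultimately show ?thesis
    using mp.pairing_rank_eq[of "\<lambda>f g. coeff_sum w (f * g)", OF linear_coeff_sum_mult
        subspace_forms[of r d] forms_subset_span finite_monomial_basis
        subspace_forms[of r j] forms_subset_span finite_monomial_basis]
    by simp
qed

section \<open>Counting monomials of degrees 0, 1 and 2\<close>

lemma monomials_0: "monomials r 0 = {0}"
  by (auto simp: monomials_def mon_deg_0_iff)

lemma monomials_no_vars: "monomials 0 (Suc d) = {}"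
  by (auto simp: monomials_def mon_deg_def)

text \<open>The recurrence of Pascal's triangle: either the last variable does not occur in the
  monomial, or it can be divided out.\<close>

lemma card_monomials_Suc_Suc:
  "card (monomials (Suc r) (Suc d)) = card (monomials r (Suc d)) + card (monomials (Suc r) d)"
proof -
  let ?f = "\<lambda>n. Poly_Mapping.single r 1 + n :: nat \<Rightarrow>\<^sub>0 nat"
  have "monomials (Suc r) (Suc d) = monomials r (Suc d) \<union> ?f ` monomials (Suc r) d"
  proof (intro equalityI subsetI)
    fix m assume m: "m \<in> monomials (Suc r) (Suc d)"
    show "m \<in> monomials r (Suc d) \<union> ?f ` monomials (Suc r) d"
    proof (cases "r \<in> Poly_Mapping.keys m")
      case True
      define n where "n = m - Poly_Mapping.single r 1"
      have eq: "m = ?f n"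
        using True by (intro poly_mapping_eqI) (auto simp: n_def lookup_add lookup_minus lookup_single when_def in_keys_iff)
      then have "n \<in> monomials (Suc r) d"
        using m by (auto simp: monomials_def keys_add_nat mon_deg_add)
      then show ?thesis using eq by blast
    next
      case False
      then show ?thesis using m by (auto simp: monomials_def less_Suc_eq)
    qed
  next
    fix m assume "m \<in> monomials r (Suc d) \<union> ?f ` monomials (Suc r) d"
    then show "m \<in> monomials (Suc r) (Suc d)"
      by (auto simp: monomials_def keys_add_nat mon_deg_add less_Suc_eq)
  qed
  moreover have "monomials r (Suc d) \<inter> ?f ` monomials (Suc r) d = {}"
    by (auto simp: monomials_def keys_add_nat)
  moreover have "card (?f ` monomials (Suc r) d) = card (monomials (Suc r) d)"
    by (intro card_image inj_onI) simp
  ultimately show ?thesis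
    by (simp add: card_Un_disjoint finite_monomials)
qed

lemma card_monomials_1: "card (monomials r 1) = r"
  by (induction r) (simp_all add: monomials_no_vars card_monomials_Suc_Suc monomials_0)

lemma card_monomials_2: "card (monomials r 2) = (r + 1) choose 2"
proof (induction r)
  case 0
  then show ?case using monomials_no_vars[of 1] by (simp add: numeral_2_eq_2)
next
  case (Suc r)
  then show ?case
    using card_monomials_Suc_Suc[of r 1] card_monomials_1[of "Suc r"] by (simp add: numeral_2_eq_2)
qed

lemma dim_forms_0: "mp.dim (forms r 0 :: 'k::field mpoly set) = 1"
  by (simp add: dim_forms monomials_0)

lemma dim_zero_space: "mp.dim {0 :: 'k::field mpoly} = 0"
  using mp.dim_eq_card_independent[OF mp.independent_empty] mp.dim_span[of "{} :: 'k mpoly set"] by simp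

lemma (in mpoly_ideal) forms_0_inter:
  assumes "1 \<notin> I"
  shows "forms r 0 \<inter> I = {0}"
proof -
  have "f = 0" if f: "f \<in> forms r 0" "f \<in> I" for f
  proof (rule ccontr)
    assume "f \<noteq> 0"
    have "f = Poly_Mapping.single 0 (Poly_Mapping.lookup f 0)"
      using f(1) by (intro poly_mapping_eqI) (auto simp: forms_iff monomials_0 lookup_single when_def in_keys_iff)
    moreover from this \<open>f \<noteq> 0\<close> have "Poly_Mapping.lookup f 0 \<noteq> 0" by (metis single_zero)
    ultimately have "f * Poly_Mapping.single 0 (inverse (Poly_Mapping.lookup f 0)) = 1"
      by (metis add_0 mult_single right_inverse single_one)
    then show False
      using I_mult[OF f(2), of "Poly_Mapping.single 0 (inverse (Poly_Mapping.lookup f 0))"] assms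
      by (simp add: single_in_carrier)
  qed
  then show ?thesis using mp.subspace_0[OF subspace_forms] by auto
qed

section \<open>Macaulay duality\<close>

lemma has_h_vector_dims:
  fixes I :: "'k::field mpoly set"
  assumes I: "ideal I (mpoly_ring r)" and h: "has_h_vector r I h"
  shows "1 \<notin> I"
    and "mp.dim (forms r d :: 'k mpoly set) = (if d < length h then h ! d else 0) + mp.dim (forms r d \<inter> I)"
proof -
  interpret mpoly_ideal r I using I by (simp add: mpoly_ideal_def)
  have len: "length h - 1 < length h" using h by (cases h) (auto simp: has_h_vector_def)
  have kd: "has_kdim r I (graded_piece r I d) (if d < length h then h ! d else 0)" for d
    using h by (simp add: has_h_vector_def)
  have "h ! (length h - 1) > 0" using h by (auto simp: has_h_vector_def last_conv_nth)
  then show one: "1 \<notin> I"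
    using proper_of_has_kdim[OF kd[of "length h - 1"]] len by simp
  show "mp.dim (forms r d :: 'k mpoly set) = (if d < length h then h ! d else 0) + mp.dim (forms r d \<inter> I)"
    using kd has_kdim_graded_piece_iff[OF one] by blast
qed

lemma has_h_vector_length_le:
  assumes I: "ideal I (mpoly_ring r)" and h: "has_h_vector r I h" "has_h_vector r I h'"
  shows "length h \<le> length h'"
proof (rule ccontr)
  assume "\<not> length h \<le> length h'"
  moreover from this have "length h - 1 < length h" "\<not> length h - 1 < length h'" by auto
  ultimately have "h ! (length h - 1) = 0"
    using has_h_vector_dims(2)[OF I h(1), of "length h - 1"] has_h_vector_dims(2)[OF I h(2), of "length h - 1"]
    by auto
  then show False using h(1) by (auto simp: has_h_vector_def last_conv_nth)
qed

text \<open>\<open>level_of_type\<close> quantifies over an h-vector of its own. Uniqueness of its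
  length and last entry ties the socle condition to the h-vector at hand.\<close>

lemma has_h_vector_last_unique:
  assumes I: "ideal I (mpoly_ring r)" and h: "has_h_vector r I h" "has_h_vector r I h'"
  shows "length h = length h'" "last h = last h'"
proof -
  show len: "length h = length h'"
    using has_h_vector_length_le[OF I h] has_h_vector_length_le[OF I h(2,1)] by simp
  have "h \<noteq> []" "h' \<noteq> []" using h by (auto simp: has_h_vector_def)
  then show "last h = last h'"
    using has_h_vector_dims(2)[OF I h(1), of "length h - 1"] has_h_vector_dims(2)[OF I h(2), of "length h - 1"] len
    by (auto simp: last_conv_nth)
qed

text \<open>As h_e = 1, the ideal meets R_e in a hyperplane, and \<open>w\<close> encodes a
  functional with that kernel. Closure under multiplication puts the forms of \<open>I\<close> into
  \<open>apolar r w\<close>. For the converse the socle condition is used, going down from degree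
  \<open>e\<close>.\<close>

lemma gorenstein_dual_weight:
  fixes I :: "'k::field mpoly set"
  assumes I: "homogeneous_ideal r I" and g: "gorenstein r I" and h: "has_h_vector r I h"
    and e: "length h = Suc e"
  obtains w where "homogeneous_weight e w" "\<And>d. d \<le> e \<Longrightarrow> forms r d \<inter> I = forms r d \<inter> apolar r w"
    "h ! e = 1"
proof -
  have id: "ideal I (mpoly_ring r)" using I by (simp add: homogeneous_ideal_def)
  interpret mpoly_ideal r I using id by (simp add: mpoly_ideal_def)
  obtain h' where h': "has_h_vector r I h'" "socle r I \<subseteq> graded_piece r I (length h' - 1)" "last h' = 1"
    using g unfolding gorenstein_def level_of_type_def by metis
  have "length h' - 1 = e"
    using has_h_vector_last_unique(1)[OF id h h'(1)] e by simp
  then have soc: "socle r I \<subseteq> graded_piece r I e" using h'(2) by simp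
  have "last h = 1" using has_h_vector_last_unique[OF id h h'(1)] h'(3) by simp
  then have he: "h ! e = 1" using e by (cases h rule: rev_cases) auto
  have dim: "mp.dim (forms r e :: 'k mpoly set) = 1 + mp.dim (forms r e \<inter> I)"
    using has_h_vector_dims(2)[OF id h, of e] e he by simp
  then have "\<not> forms r e \<subseteq> I" by (auto simp: Int_absorb2)
  then obtain b where b: "b \<in> forms r e" "b \<notin> I" by blast
  have FI: "mp.subspace (forms r e \<inter> I)" by (rule mp.subspace_inter[OF subspace_forms subspace_I])
  have "mp.span (insert b (forms r e \<inter> I)) = forms r e"
  proof (rule mp.subspace_eq_of_dim_le[OF mp.subspace_span _ forms_subset_span finite_monomial_basis])
    show "mp.span (insert b (forms r e \<inter> I)) \<subseteq> forms r e"
      using b by (intro mp.span_minimal subspace_forms) auto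
    have "mp.dim (mp.span (insert b (forms r e \<inter> I))) = mp.dim (forms r e \<inter> I) + 1"
      using b forms_subset_span[of r e] by (intro mp.dim_span_insert_finite[OF FI _ finite_monomial_basis[of r e]]) auto
    then show "mp.dim (forms r e :: 'k mpoly set) \<le> mp.dim (mp.span (insert b (forms r e \<inter> I)))"
      using dim by simp
  qed
  then have ex: "\<exists>c. f - smul c b \<in> I" if "f \<in> forms r e" for f
    using that mp.span_breakdown_eq[of f b "forms r e \<inter> I"] mp.span_eq_iff[THEN iffD2, OF FI] by auto
  \<comment> \<open>With \<open>b\<close> spanning R_e modulo \<open>I\<close>, the value
    \<open>w m\<close> is the coordinate of the class of \<open>m\<close>. The default 0 confines
    the functional to degree \<open>e\<close>.\<close>
  define w where "w m = (if m \<in> monomials r e then SOME c. Poly_Mapping.single m 1 - smul c b \<in> I else 0)" for m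
  have w: "Poly_Mapping.single m 1 - smul (w m) b \<in> I" if "m \<in> monomials r e" for m
    using someI_ex[OF ex[OF single_in_forms[OF that]]] that by (simp add: w_def)
  have hw: "homogeneous_weight e w" by (auto simp: homogeneous_weight_def w_def monomials_def)
  have diff: "f - smul (coeff_sum w f) b \<in> I" if f: "f \<in> forms r e" for f
  proof -
    have "f - smul (coeff_sum w f) b = (\<Sum>m\<in>Poly_Mapping.keys f. smul (Poly_Mapping.lookup f m) (Poly_Mapping.single m 1))
        - (\<Sum>m\<in>Poly_Mapping.keys f. smul (Poly_Mapping.lookup f m) (smul (w m) b))"
      by (simp only: mpoly_sum_monomials) (simp add: coeff_sum_def mp.scale_sum_left)
    also have "\<dots> = (\<Sum>m\<in>Poly_Mapping.keys f. smul (Poly_Mapping.lookup f m) (Poly_Mapping.single m 1 - smul (w m) b))"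
      by (simp only: sum_subtractf mp.scale_right_diff_distrib)
    also have "\<dots> \<in> I"
      using w f by (intro mp.subspace_sum[OF subspace_I] mp.subspace_scale[OF subspace_I]) (auto simp: forms_iff)
    finally show ?thesis .
  qed
  have top: "f \<in> I \<longleftrightarrow> coeff_sum w f = 0" if f: "f \<in> forms r e" for f
  proof
    assume "f \<in> I"
    then have "smul (coeff_sum w f) b \<in> I"
      using mp.subspace_diff[OF subspace_I _ diff[OF f], of f] by simp
    then have "smul (inverse (coeff_sum w f)) (smul (coeff_sum w f) b) \<in> I"
      by (rule mp.subspace_scale[OF subspace_I])
    then show "coeff_sum w f = 0" using b(2) by (cases "coeff_sum w f = 0") auto
  next
    assume "coeff_sum w f = 0"
    then show "f \<in> I" using diff[OF f] by simp
  qed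
  have le: "f \<in> apolar r w" if f: "f \<in> forms r d" "f \<in> I" and d: "d \<le> e" for f d
  proof -
    have "homogeneous_weight (d + (e - d)) w" using hw d by simp
    moreover have "coeff_sum w (f * g) = 0" if "g \<in> forms r (e - d)" for g
    proof -
      have "f * g \<in> forms r e" using forms_mult[OF f(1) that] d by simp
      moreover have "f * g \<in> I" using I_mult[OF f(2)] that forms_subset_carrier by blast
      ultimately show ?thesis using top by blast
    qed
    ultimately show ?thesis using apolar_form_iff[OF _ f(1)] by blast
  qed
  \<comment> \<open>Here \<open>k\<close> is the distance to the top degree. By induction every
    variable multiplies \<open>f\<close> into \<open>I\<close>, so the class of \<open>f\<close>
    lies in the socle and hence in degree \<open>e\<close>.\<close>
  have ge: "f \<in> I" if "f \<in> forms r d" "f \<in> apolar r w" "d + k = e" for f d k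
    using that
  proof (induction k arbitrary: f d)
    case 0
    then have "coeff_sum w (f * 1) = 0"
      using one_closed unfolding apolar_def by (simp del: mult_1_right)
    then show ?case using top 0 by simp
  next
    case (Suc k)
    have fc: "f \<in> carrier (mpoly_ring r)" using Suc.prems forms_subset_carrier by blast
    have x: "f * Poly_Mapping.single (Poly_Mapping.single i 1) 1 \<in> I" if "i < r" for i
    proof -
      have i: "Poly_Mapping.single i 1 \<in> monomials r 1" using that by (simp add: monomials_def)
      have s: "Poly_Mapping.single (Poly_Mapping.single i 1) 1 \<in> (forms r 1 :: 'k mpoly set)"
        by (rule single_in_forms[OF i])
      have sc: "Poly_Mapping.single (Poly_Mapping.single i 1) 1 \<in> carrier (mpoly_ring r :: 'k mpoly ring)"
        using s forms_subset_carrier by blast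
      have "f * Poly_Mapping.single (Poly_Mapping.single i 1) 1 \<in> apolar r w"
        using mpoly_ideal.I_mult[OF mpoly_ideal_apolar Suc.prems(2) sc] .
      then show ?thesis
        using Suc.IH[OF forms_mult[OF Suc.prems(1) s]] Suc.prems(3) by simp
    qed
    have "f * g \<in> I" if g: "g \<in> carrier (mpoly_ring r)" "Poly_Mapping.lookup g 0 = 0" for g
    proof -
      have "f * Poly_Mapping.single m 1 \<in> I" if m: "m \<in> Poly_Mapping.keys g" for m
      proof -
        have "m \<noteq> 0" using m g(2) by (metis in_keys_iff)
        then obtain j where j: "mon_deg m = Suc j" using mon_deg_0_iff not0_implies_Suc by blast
        have "m \<in> monomials r (Suc j)" using m g(1) j by (auto simp: monomials_def mpoly_ring_def)
        then obtain i n where n: "i < r" "n \<in> monomials r j" "m = Poly_Mapping.single i 1 + n"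
          by (rule monomials_Suc_obtain)
        have "(Poly_Mapping.single n 1 :: 'k mpoly) \<in> carrier (mpoly_ring r)"
          using n(2) by (intro single_in_carrier) (simp add: monomials_def)
        then have "f * Poly_Mapping.single (Poly_Mapping.single i 1) 1 * Poly_Mapping.single n 1 \<in> I"
          using I_mult[OF x[OF n(1)]] by blast
        then show ?thesis by (simp add: n(3) mult.assoc mult_single)
      qed
      then have "(\<Sum>m\<in>Poly_Mapping.keys g. smul (Poly_Mapping.lookup g m) (f * Poly_Mapping.single m 1)) \<in> I"
        by (intro mp.subspace_sum[OF subspace_I] mp.subspace_scale[OF subspace_I])
      also have "(\<Sum>m\<in>Poly_Mapping.keys g. smul (Poly_Mapping.lookup g m) (f * Poly_Mapping.single m 1)) = f * g"
        by (simp only: smul_mult_right[symmetric] sum_distrib_left[symmetric] mpoly_sum_monomials)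
      finally show ?thesis .
    qed
    then have "cls f \<in> socle r I" using socle_iff[OF fc] by blast
    then obtain t where t: "t \<in> forms r e" "cls f = cls t"
      using soc by (auto simp: graded_piece_def quot_image_def)
    then have ft: "f - t \<in> I" using cls_eq_iff[OF fc, of t] forms_subset_carrier by blast
    \<comment> \<open>Since \<open>d < e\<close>, the form \<open>t\<close> of degree
      \<open>e\<close> contributes nothing in degree \<open>d\<close>; homogeneity of
      \<open>I\<close> then yields \<open>f\<close> itself.\<close>
    have "hom_component d (f - t) = f"
      using Suc.prems t(1) by (intro poly_mapping_eqI)
        (auto simp: lookup_hom_component lookup_minus forms_iff monomials_def in_keys_iff)
    then show ?case using I ft unfolding homogeneous_ideal_def by metis
  qed
  show thesis
  proof (rule that[OF hw _ he])
    fix d assume d: "d \<le> e"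
    then have "d + (e - d) = e" by simp
    then show "forms r d \<inter> I = forms r d \<inter> apolar r w" using le[OF _ _ d] ge by blast
  qed
qed

text \<open>A component of a socle element in degree d < e pairs to zero with all forms of the
  positive degree e - d, so it already lies in the ideal, as does every component above degree e.
  Conversely, a form of degree e is killed by every polynomial without constant term, since only
  constants pair with degree e.\<close>

lemma socle_apolar:
  assumes w: "homogeneous_weight e w"
  shows "socle r (apolar r w) = graded_piece r (apolar r w) e"
proof -
  interpret mpoly_ideal r "apolar r w" by (rule mpoly_ideal_apolar)
  show ?thesis
  proof (intro equalityI subsetI)
    fix x assume x: "x \<in> socle r (apolar r w)"
    then obtain f where f: "f \<in> carrier (mpoly_ring r)" "x = cls f"
      by (auto simp: socle_def carrier_Quot)
    have low: "hom_component d f \<in> apolar r w" if d: "d \<noteq> e" for d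
    proof (cases "d < e")
      case True
      then have w': "homogeneous_weight (d + (e - d)) w" using w by simp
      have "coeff_sum w (hom_component d f * g) = 0" if g: "g \<in> forms r (e - d)" for g
      proof -
        have gc: "g \<in> carrier (mpoly_ring r)" using g forms_subset_carrier by blast
        \<comment> \<open>A form of positive degree has no constant term, so the class of
          \<open>g\<close> lies in the maximal ideal.\<close>
        have "Poly_Mapping.lookup g 0 = 0"
          using g True by (auto simp: forms_iff monomials_def in_keys_iff mon_deg_def)
        then have "f * g \<in> apolar r w" using x f socle_iff[OF f(1)] gc by blast
        then have "coeff_sum w (f * g * 1) = 0"
          using one_closed unfolding apolar_def by (simp del: mult_1_right)
        then show ?thesis using coeff_sum_mult_form_component[OF w' f(1) g] by simp
      qed
      then show ?thesis using apolar_form_iff[OF w' hom_component_in_forms[OF f(1)]] by blast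
    next
      case False
      then show ?thesis using d forms_subset_apolar[OF w] hom_component_in_forms[OF f(1)] by (meson linorder_neqE_nat subsetD)
    qed
    let ?D = "insert e (mon_deg ` Poly_Mapping.keys f)"
    have "f = (\<Sum>d\<in>?D. hom_component d f)" by (rule sum_hom_component[symmetric]) auto
    also have "\<dots> = hom_component e f + (\<Sum>d\<in>?D - {e}. hom_component d f)"
      by (rule sum.remove) auto
    finally have "f - hom_component e f = (\<Sum>d\<in>?D - {e}. hom_component d f)"
      by (simp add: algebra_simps)
    moreover have "(\<Sum>d\<in>?D - {e}. hom_component d f) \<in> apolar r w"
      using low by (intro mp.subspace_sum[OF subspace_I]) auto
    ultimately have "f - hom_component e f \<in> apolar r w" by simp
    moreover have fe: "hom_component e f \<in> forms r e" by (rule hom_component_in_forms[OF f(1)])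
    ultimately have "x = cls (hom_component e f)"
      using cls_eq_iff[OF f(1), of "hom_component e f"] forms_subset_carrier f(2) by blast
    then show "x \<in> graded_piece r (apolar r w) e"
      using fe by (auto simp: graded_piece_def quot_image_def)
  next
    fix x assume "x \<in> graded_piece r (apolar r w) e"
    then obtain f where f: "f \<in> forms r e" "x = cls f" by (auto simp: graded_piece_def quot_image_def)
    have fc: "f \<in> carrier (mpoly_ring r)" using f forms_subset_carrier by blast
    have "f * g \<in> apolar r w" if g: "g \<in> carrier (mpoly_ring r)" "Poly_Mapping.lookup g 0 = 0" for g
      unfolding apolar_def
    proof (intro CollectI conjI ballI carrier_mult fc g)
      fix k :: "'a mpoly" assume k: "k \<in> carrier (mpoly_ring r)"
      have "0 \<notin> Poly_Mapping.keys (g * k)"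
      proof
        assume "0 \<in> Poly_Mapping.keys (g * k)"
        then obtain m n where mn: "0 = m + n" "m \<in> Poly_Mapping.keys g" using keys_mult[of g k] by blast
        then have "mon_deg m = 0" using mon_deg_add[of m n] by (simp add: mon_deg_def)
        then show False using mn g(2) by (simp add: mon_deg_0_iff in_keys_iff)
      qed
      then have "hom_component 0 (g * k) = 0"
        by (intro poly_mapping_eqI) (simp add: lookup_hom_component mon_deg_0_iff in_keys_iff)
      moreover have "coeff_sum w (f * (g * k)) = coeff_sum w (f * hom_component 0 (g * k))"
        using coeff_sum_eq_hom_component[OF w carrier_mult[OF fc carrier_mult[OF g(1) k]]]
          hom_component_mult_form[OF f(1) carrier_mult[OF g(1) k], of 0] by simp
      ultimately show "coeff_sum w (f * g * k) = 0" by (simp add: mult.assoc)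
    qed
    then show "x \<in> socle r (apolar r w)" using socle_iff[OF fc] f(2) by blast
  qed
qed

text \<open>The converse half of the duality. The socle is the piece of degree \<open>e\<close>,
  which has dimension one because it is paired with the constants.\<close>

lemma gorenstein_apolar:
  fixes w :: "(nat \<Rightarrow>\<^sub>0 nat) \<Rightarrow> 'k::field"
  assumes w: "homogeneous_weight e w" and one: "1 \<notin> apolar r w"
    and lin: "forms r 1 \<inter> apolar r w = {0}"
    and h: "length h = Suc e" "\<And>d. d \<le> e \<Longrightarrow>
      mp.dim (forms r d :: 'k mpoly set) = h ! d + mp.dim (forms r d \<inter> apolar r w)"
  shows "standard_graded_artinian r (apolar r w)" "gorenstein r (apolar r w)"
    "has_h_vector r (apolar r w) h"
proof -
  interpret mpoly_ideal r "apolar r w" by (rule mpoly_ideal_apolar)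
  have "artinian_ring (mpoly_ring r Quot apolar r w)"
    by (rule artinian_quot[OF forms_subset_apolar[OF w]])
  then show "standard_graded_artinian r (apolar r w)"
    unfolding standard_graded_artinian_def
    using homogeneous_ideal_apolar[OF w] lin by blast
  have "mp.dim (forms r e :: 'k mpoly set) = 1 + mp.dim (forms r e \<inter> apolar r w)"
    using dim_forms_apolar_symmetric[of 0 e w r] w forms_0_inter[OF one]
    by (simp add: dim_zero_space dim_forms_0)
  then have he: "h ! e = 1" using h(2)[of e] by simp
  then have last: "last h = 1" using h(1) by (cases h rule: rev_cases) auto
  have kd: "has_kdim r (apolar r w) (graded_piece r (apolar r w) d) (if d < length h then h ! d else 0)" for d
  proof (cases "d \<le> e")
    case True
    then show ?thesis using h has_kdim_graded_piece_iff[OF one] by simp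
  next
    case False
    then have "forms r d \<inter> apolar r w = forms r d"
      using forms_subset_apolar[OF w, of d r] by auto
    then show ?thesis using False h has_kdim_graded_piece_iff[OF one] by simp
  qed
  show hv: "has_h_vector r (apolar r w) h"
    unfolding has_h_vector_def using kd last h(1) by auto
  show "gorenstein r (apolar r w)"
    unfolding gorenstein_def level_of_type_def
    using hv last h(1) kd[of e] he by (intro exI[of _ h]) (simp add: socle_apolar[OF w])
qed

section \<open>Changing the quartic by a rank one term\<close>

text \<open>Summing the coefficients of the monomials supported in \<open>S\<close> is evaluation at the indicator vector of \<open>S\<close>.\<close>

lemma coeff_sum_indicator_mult:
  "coeff_sum (\<lambda>m. if Poly_Mapping.keys m \<subseteq> S then 1 else 0) (f * g)
    = coeff_sum (\<lambda>m. if Poly_Mapping.keys m \<subseteq> S then 1 else 0) f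
      * coeff_sum (\<lambda>m. if Poly_Mapping.keys m \<subseteq> S then 1 else 0) g"
proof -
  have *: "(if Poly_Mapping.keys (m + n) \<subseteq> S then 1 else 0 :: 'a)
    = (if Poly_Mapping.keys m \<subseteq> S then 1 else 0) * (if Poly_Mapping.keys n \<subseteq> S then 1 else 0)"
    for m n :: "nat \<Rightarrow>\<^sub>0 nat"
    by (simp add: keys_add_nat)
  show ?thesis
    unfolding coeff_sum_mult * coeff_sum_def[of _ f] coeff_sum_def[of _ g] sum_product
    by (intro sum.cong refl) (simp only: mult_ac)
qed

text \<open>A quadratic monomial is a product of two variables, and the pair is recovered from the
  support. This is special to low degree: in degree 3 the monomials x^2 y and x y^2 share their
  support.\<close>

lemma quadratic_monomial_eqI:
  assumes "m \<in> monomials r 2" "n \<in> monomials r 2" "Poly_Mapping.keys m = Poly_Mapping.keys n"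
  shows "m = n"
proof -
  have ex: "\<exists>i j. m = Poly_Mapping.single i 1 + Poly_Mapping.single j 1" if m: "m \<in> monomials r 2" for m
  proof -
    have "m \<in> monomials r (Suc 1)" using m by (simp add: numeral_2_eq_2)
    then obtain i n where n: "n \<in> monomials r 1" "m = Poly_Mapping.single i 1 + n"
      by (rule monomials_Suc_obtain)
    have "n \<in> monomials r (Suc 0)" using n(1) by simp
    then obtain j k where "k \<in> monomials r 0" "n = Poly_Mapping.single j 1 + k"
      by (rule monomials_Suc_obtain)
    then show ?thesis using n by (auto simp: monomials_0)
  qed
  obtain i j k l where "m = Poly_Mapping.single i 1 + Poly_Mapping.single j 1"
    "n = Poly_Mapping.single k 1 + Poly_Mapping.single l 1"
    using ex[OF assms(1)] ex[OF assms(2)] by blast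
  then show ?thesis
    using assms(3) by (auto simp: keys_add_nat doubleton_eq_iff add.commute)
qed

text \<open>
  Take \<open>S\<close> to be a minimal support of a monomial of \<open>q\<close>: a quadratic monomial is determined by
  its support, so only one coefficient of \<open>q\<close> survives.
\<close>

lemma quadratic_form_nonvanishing:
  assumes q: "q \<in> forms r 2" "q \<noteq> 0"
  shows "\<exists>S. coeff_sum (\<lambda>m. if Poly_Mapping.keys m \<subseteq> S then 1 else 0) q \<noteq> 0"
proof -
  have "\<exists>m. m \<in> Poly_Mapping.keys q" using q(2) by (metis all_not_in_conv keys_eq_empty)
  then obtain m where m: "m \<in> Poly_Mapping.keys q"
    "\<And>n. n \<in> Poly_Mapping.keys q \<Longrightarrow> card (Poly_Mapping.keys m) \<le> card (Poly_Mapping.keys n)"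
    using ex_has_least_nat[of "\<lambda>m. m \<in> Poly_Mapping.keys q" _ "\<lambda>m. card (Poly_Mapping.keys m)"] by blast
  have "n = m" if n: "n \<in> Poly_Mapping.keys q" "Poly_Mapping.keys n \<subseteq> Poly_Mapping.keys m" for n
  proof (rule quadratic_monomial_eqI)
    show "n \<in> monomials r 2" "m \<in> monomials r 2" using n m q(1) by (auto simp: forms_iff)
    show "Poly_Mapping.keys n = Poly_Mapping.keys m"
      using n m(2)[OF n(1)] by (intro card_seteq) auto
  qed
  then have "coeff_sum (\<lambda>n. if Poly_Mapping.keys n \<subseteq> Poly_Mapping.keys m then 1 else 0) q
      = (\<Sum>n\<in>Poly_Mapping.keys q. if n = m then Poly_Mapping.lookup q n else 0)"
    unfolding coeff_sum_def by (intro sum.cong refl) auto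
  also have "\<dots> = Poly_Mapping.lookup q m" using m(1) by simp
  finally show ?thesis using m(1) by (metis in_keys_iff)
qed

lemma quartic_weight_step:
  fixes w :: "(nat \<Rightarrow>\<^sub>0 nat) \<Rightarrow> 'k::field"
  assumes w: "homogeneous_weight 4 w" and q: "q \<in> forms r 2 \<inter> apolar r w" "q \<noteq> 0"
  obtains w' :: "(nat \<Rightarrow>\<^sub>0 nat) \<Rightarrow> 'k" where "homogeneous_weight 4 w'"
    "mp.dim (forms r 2 \<inter> apolar r w) = mp.dim (forms r 2 \<inter> apolar r w') + 1"
    "\<And>d. d \<le> 2 \<Longrightarrow> forms r d \<inter> apolar r w' \<subseteq> apolar r w"
proof -
  interpret mpoly_ideal r "apolar r w" by (rule mpoly_ideal_apolar)
  obtain S where S: "coeff_sum (\<lambda>m. if Poly_Mapping.keys m \<subseteq> S then 1 else 0) q \<noteq> 0"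
    using quadratic_form_nonvanishing q by blast
  define v :: "(nat \<Rightarrow>\<^sub>0 nat) \<Rightarrow> 'k" where "v m = (if Poly_Mapping.keys m \<subseteq> S then 1 else 0)" for m
  have vq: "coeff_sum v q \<noteq> 0" using S by (simp add: v_def[abs_def])
  have vm: "coeff_sum v (f * g) = coeff_sum v f * coeff_sum v g" for f g
    unfolding v_def[abs_def] by (rule coeff_sum_indicator_mult)
  \<comment> \<open>Evaluation is not homogeneous as a functional, so only its degree 4 part is
    added. On products of two quadrics this part agrees with full evaluation.\<close>
  define w' where "w' m = w m + (if mon_deg m = 4 then v m else 0)" for m
  have w4: "homogeneous_weight 4 w'" using w by (simp add: homogeneous_weight_def w'_def)
  have w22: "homogeneous_weight (2 + 2) w" "homogeneous_weight (2 + 2) w'" using w w4 by simp_all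
  have w': "coeff_sum w' (f * g) = coeff_sum w (f * g) + coeff_sum v f * coeff_sum v g"
    if "f \<in> forms r 2" "g \<in> forms r 2" for f g
  proof -
    have fg: "f * g \<in> forms r 4" using forms_mult[OF that] by simp
    have "coeff_sum w' (f * g) = coeff_sum w (f * g) + coeff_sum (\<lambda>m. if mon_deg m = 4 then v m else 0) (f * g)"
      unfolding w'_def[abs_def] by (rule coeff_sum_weight_add)
    also have "coeff_sum (\<lambda>m. if mon_deg m = 4 then v m else 0) (f * g) = coeff_sum v (f * g)"
      unfolding coeff_sum_def using fg by (intro sum.cong refl) (auto simp: forms_iff monomials_def)
    finally show ?thesis by (simp add: vm)
  qed
  have eq: "forms r 2 \<inter> apolar r w' = {f \<in> forms r 2 \<inter> apolar r w. coeff_sum v f = 0}"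
  proof (intro equalityI subsetI)
    fix f assume "f \<in> forms r 2 \<inter> apolar r w'"
    then have f: "f \<in> forms r 2" "\<forall>g\<in>forms r 2. coeff_sum w' (f * g) = 0"
      using apolar_form_iff[OF w22(2)] by auto
    have q2: "q \<in> forms r 2" "\<forall>g\<in>forms r 2. coeff_sum w (q * g) = 0"
      using q apolar_form_iff[OF w22(1)] by auto
    \<comment> \<open>The test element is \<open>g = q\<close>: its product with \<open>f\<close>
      has value 0 under \<open>w\<close> because \<open>q\<close> is in the old radical.\<close>
    have "coeff_sum v f * coeff_sum v q = 0"
      using f q2 w'[OF f(1) q2(1)] by (simp add: mult.commute[of f])
    then have v0: "coeff_sum v f = 0" using vq by simp
    then have "\<forall>g\<in>forms r 2. coeff_sum w (f * g) = 0" using f w'[OF f(1)] by simp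
    then show "f \<in> {f \<in> forms r 2 \<inter> apolar r w. coeff_sum v f = 0}"
      using f(1) v0 apolar_form_iff[OF w22(1)] by blast
  next
    fix f assume "f \<in> {f \<in> forms r 2 \<inter> apolar r w. coeff_sum v f = 0}"
    then have f: "f \<in> forms r 2" "\<forall>g\<in>forms r 2. coeff_sum w (f * g) = 0" "coeff_sum v f = 0"
      using apolar_form_iff[OF w22(1)] by auto
    then have "\<forall>g\<in>forms r 2. coeff_sum w' (f * g) = 0" using w'[OF f(1)] by simp
    then show "f \<in> forms r 2 \<inter> apolar r w'" using f(1) apolar_form_iff[OF w22(2)] by blast
  qed
  show thesis
  proof (rule that[OF w4])
    show "mp.dim (forms r 2 \<inter> apolar r w) = mp.dim (forms r 2 \<inter> apolar r w') + 1"
      unfolding eq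
      by (rule mp.dim_kernel_functional[OF linear_coeff_sum mp.subspace_inter[OF subspace_forms subspace_I] _
            finite_monomial_basis q(1) vq])
        (use forms_subset_span in blast)
    fix d :: nat assume d: "d \<le> 2"
    show "forms r d \<inter> apolar r w' \<subseteq> apolar r w"
    proof
      fix f assume f: "f \<in> forms r d \<inter> apolar r w'"
      show "f \<in> apolar r w"
      \<comment> \<open>Multiplying by forms of degree \<open>2 - d\<close> lands in degree 2, where
        the new radical is contained in the old one. The cases \<open>d = 0\<close> and
        \<open>d = 1\<close> later keep 1 and the linear forms out of the new ideal.\<close>
      proof (rule apolar_of_mult_forms[of d "2 - d" 2])
        show "homogeneous_weight (d + (2 - d) + 2) w" using w d by simp
        show "f \<in> forms r d" using f by simp
        fix g :: "'k mpoly" assume g: "g \<in> forms r (2 - d)"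
        have "f * g \<in> apolar r w'"
          using mpoly_ideal.I_mult[OF mpoly_ideal_apolar] f g forms_subset_carrier by blast
        moreover have "f * g \<in> forms r 2" using forms_mult[of f r d g "2 - d"] f g d by simp
        ultimately show "f * g \<in> apolar r w" using eq by blast
      qed
    qed
  qed
qed

section \<open>Gorenstein h-vectors of socle degree 4, given as lists of length 5\<close>

lemma socle_degree_4_shape:
  fixes I :: "'k::field mpoly set"
  assumes I: "standard_graded_artinian r I" and g: "gorenstein r I" and h: "has_h_vector r I h"
    and len: "length h = 5"
  obtains a w where "h = [1, r, a, r, 1]" "homogeneous_weight 4 w"
    "\<And>d. d \<le> 4 \<Longrightarrow> forms r d \<inter> I = forms r d \<inter> apolar r w"
    "1 \<notin> I" "forms r 1 \<inter> I = {0}"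
    "(r + 1) choose 2 = a + mp.dim (forms r 2 \<inter> I)"
proof -
  have hI: "homogeneous_ideal r I" using I by (simp add: standard_graded_artinian_def)
  then have id: "ideal I (mpoly_ring r)" by (simp add: homogeneous_ideal_def)
  interpret mpoly_ideal r I using id by (simp add: mpoly_ideal_def)
  obtain w where w: "homogeneous_weight 4 w"
    "\<And>d. d \<le> 4 \<Longrightarrow> forms r d \<inter> I = forms r d \<inter> apolar r w" "h ! 4 = 1"
    using gorenstein_dual_weight[OF hI g h, of 4] len by auto
  have one: "1 \<notin> I" by (rule has_h_vector_dims(1)[OF id h])
  have dims: "mp.dim (forms r d :: 'k mpoly set) = h ! d + mp.dim (forms r d \<inter> I)" if "d \<le> 4" for d
    using has_h_vector_dims(2)[OF id h, of d] that len by simp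
  have lin: "forms r 1 \<inter> I = {0}"
    using I mp.subspace_0[OF subspace_forms] by (auto simp: standard_graded_artinian_def)
  have h0: "h ! 0 = 1"
    using dims[of 0] by (simp add: dim_forms_0 forms_0_inter[OF one] dim_zero_space)
  \<comment> \<open>The ideal contains no nonzero linear form, so the codimension is the number of
    variables.\<close>
  have h1: "h ! 1 = r"
    using dims[of 1] by (simp add: dim_forms card_monomials_1 lin dim_zero_space del: One_nat_def)
  have "mp.dim (forms r 3 :: 'k mpoly set) + mp.dim (forms r 1 \<inter> I) = mp.dim (forms r 1 :: 'k mpoly set) + mp.dim (forms r 3 \<inter> I)"
    using dim_forms_apolar_symmetric[of 1 3 w r] w by simp
  then have h3: "h ! 3 = r"
    using dims[of 3] h1 by (simp add: dim_forms card_monomials_1 lin dim_zero_space del: One_nat_def)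
  have "h = [1, r, h ! 2, r, 1]"
    using len h0 h1 h3 w(3) by (intro nth_equalityI) (auto simp: nth_Cons' less_Suc_eq numeral_eq_Suc)
  moreover have "(r + 1) choose 2 = h ! 2 + mp.dim (forms r 2 \<inter> I)"
    using dims[of 2] by (simp add: dim_forms card_monomials_2)
  ultimately show thesis using that w one lin by blast
qed

lemma gorenstein_h_vector_socle_degree_4:
  assumes "gorenstein_h_vector TYPE('k::field) h" "length h = 5"
  obtains r a where "h = [1, r, a, r, 1]" "a \<le> (r + 1) choose 2"
proof -
  obtain r and I :: "'k mpoly set" where "standard_graded_artinian r I" "gorenstein r I" "has_h_vector r I h"
    using assms(1) unfolding gorenstein_h_vector_def by blast
  from socle_degree_4_shape[OF this assms(2)] show thesis
    using that by (metis le_add1)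
qed

lemma gorenstein_h_vector_step:
  assumes "gorenstein_h_vector TYPE('k::field) [1, r, a, r, 1]" and a: "a < (r + 1) choose 2"
  shows "gorenstein_h_vector TYPE('k) [1, r, Suc a, r, 1]"
proof -
  obtain s and I :: "'k mpoly set" where I: "standard_graded_artinian s I" "gorenstein s I"
    "has_h_vector s I [1, r, a, r, 1]"
    using assms(1) unfolding gorenstein_h_vector_def by blast
  obtain a' w where *: "[1, r, a, r, 1] = [1, s, a', s, 1]" "homogeneous_weight 4 w"
    "\<And>d. d \<le> 4 \<Longrightarrow> forms s d \<inter> I = forms s d \<inter> apolar s w"
    "1 \<notin> I" "forms s 1 \<inter> I = {0}" "(s + 1) choose 2 = a' + mp.dim (forms s 2 \<inter> I)"
    by (rule socle_degree_4_shape[OF I]) auto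
  have s: "s = r" "a' = a" using *(1) by auto
  note * = *[unfolded s]
  \<comment> \<open>The dimension of the radical on R_2 is the gap between \<open>a\<close> and the
    binomial bound, so a strict inequality supplies the quadric \<open>q\<close>.\<close>
  have "mp.dim (forms r 2 \<inter> apolar r w) \<noteq> 0" using *(3)[of 2] *(6) a by simp
  then have "forms r 2 \<inter> apolar r w \<noteq> {0}" using dim_zero_space by metis
  moreover have "0 \<in> forms r 2 \<inter> apolar r w"
    using mp.subspace_0[OF subspace_forms] mpoly_ideal.zero_in_I[OF mpoly_ideal_apolar] by blast
  ultimately obtain q where q: "q \<in> forms r 2 \<inter> apolar r w" "q \<noteq> 0" by blast
  obtain w' :: "(nat \<Rightarrow>\<^sub>0 nat) \<Rightarrow> 'k" where w': "homogeneous_weight 4 w'"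
    "mp.dim (forms r 2 \<inter> apolar r w) = mp.dim (forms r 2 \<inter> apolar r w') + 1"
    "\<And>d. d \<le> 2 \<Longrightarrow> forms r d \<inter> apolar r w' \<subseteq> apolar r w"
    using quartic_weight_step[OF *(2) q] by blast
  interpret mpoly_ideal r "apolar r w'" by (rule mpoly_ideal_apolar)
  have one: "1 \<notin> apolar r w'"
  proof
    assume "1 \<in> apolar r w'"
    moreover have "1 \<in> forms r 0" by (simp add: forms_iff monomials_0)
    ultimately have "1 \<in> apolar r w" using w'(3)[of 0] by blast
    then show False using *(3)[of 0] *(4) \<open>1 \<in> forms r 0\<close> by blast
  qed
  have "forms r 1 \<inter> apolar r w' \<subseteq> {0}" using w'(3)[of 1] *(3)[of 1] *(5) by auto
  then have lin: "forms r 1 \<inter> apolar r w' = {0}"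
    using mp.subspace_0[OF subspace_forms] zero_in_I by blast
  have d0: "mp.dim (forms r 0 :: 'k mpoly set) = 1 + mp.dim (forms r 0 \<inter> apolar r w')"
    by (simp add: dim_forms_0 forms_0_inter[OF one] dim_zero_space)
  have d1: "mp.dim (forms r 1 :: 'k mpoly set) = r + mp.dim (forms r 1 \<inter> apolar r w')"
    unfolding lin by (simp only: dim_forms card_monomials_1 dim_zero_space)
  have d2: "mp.dim (forms r 2 :: 'k mpoly set) = Suc a + mp.dim (forms r 2 \<inter> apolar r w')"
    using *(6) *(3)[of 2] w'(2) by (simp add: dim_forms card_monomials_2)
  \<comment> \<open>Degrees 3 and 4 follow by symmetry from degrees 1 and 0.\<close>
  have d3: "mp.dim (forms r 3 :: 'k mpoly set) = r + mp.dim (forms r 3 \<inter> apolar r w')"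
    using dim_forms_apolar_symmetric[of 1 3 w' r] w'(1) d1 by simp
  have d4: "mp.dim (forms r 4 :: 'k mpoly set) = 1 + mp.dim (forms r 4 \<inter> apolar r w')"
    using dim_forms_apolar_symmetric[of 0 4 w' r] w'(1) d0 by simp
  have dims: "mp.dim (forms r d :: 'k mpoly set) = [1, r, Suc a, r, 1] ! d + mp.dim (forms r d \<inter> apolar r w')"
    if "d \<le> 4" for d
  proof -
    have "d = 0 \<or> d = 1 \<or> d = 2 \<or> d = 3 \<or> d = 4" using that by arith
    then show ?thesis using d0 d1 d2 d3 d4 by (elim disjE) simp_all
  qed
  show ?thesis
    unfolding gorenstein_h_vector_def
    using gorenstein_apolar[OF w'(1) one lin _ dims] by (intro exI[of _ r] exI[of _ "apolar r w'"]) simp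
qed

lemma gorenstein_h_vector_interval:
  assumes g: "gorenstein_h_vector TYPE('k::field) [1, r, a, r, 1]"
    and "a \<le> b" "b \<le> (r + 1) choose 2"
  shows "gorenstein_h_vector TYPE('k) [1, r, b, r, 1]"
  using assms(2,3)
proof (induction b rule: dec_induct)
  case base
  then show ?case using g by simp
next
  case (step b)
  then show ?case using gorenstein_h_vector_step[of r b] by simp
qed

theorem corollary2p4:
  shows "interval_conjecture_for
           {h. gorenstein_h_vector TYPE('k::field_char_0) h \<and> length h = 5}
       \<and> (\<forall>r a. gorenstein_h_vector TYPE('k) [1, r, a, r, 1] \<longrightarrow>
            (\<forall>b. a \<le> b \<and> b \<le> (r + 1) choose 2 \<longrightarrow>
               gorenstein_h_vector TYPE('k) [1, r, b, r, 1]))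
       \<and> (\<forall>r b. b > (r + 1) choose 2 \<longrightarrow>
            \<not> gorenstein_h_vector TYPE('k) [1, r, b, r, 1])"
proof (intro conjI allI impI)
  show "interval_conjecture_for {h. gorenstein_h_vector TYPE('k) h \<and> length h = 5}"
    unfolding interval_conjecture_for_def
  proof (intro allI impI, unfold mem_Collect_eq)
    fix h i \<alpha> \<beta>
    assume i: "i < length h" and \<alpha>: "0 < \<alpha>" and h: "gorenstein_h_vector TYPE('k) h \<and> length h = 5"
      and h': "gorenstein_h_vector TYPE('k) (h[i := h ! i + \<alpha>]) \<and> length (h[i := h ! i + \<alpha>]) = 5"
      and \<beta>: "\<beta> \<le> \<alpha>"
    obtain r a where ra: "h = [1, r, a, r, 1]" "a \<le> (r + 1) choose 2"
      using h gorenstein_h_vector_socle_degree_4 by blast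
    obtain s b where sb: "h[i := h ! i + \<alpha>] = [1, s, b, s, 1]" "b \<le> (s + 1) choose 2"
      using h' gorenstein_h_vector_socle_degree_4 by blast
    have "i = 0 \<or> i = 1 \<or> i = 2 \<or> i = 3 \<or> i = 4" using i h by arith
    \<comment> \<open>Both lists have the shape 1, r, a, r, 1: raising an end entry would spoil a 1,
      and raising one of the entries next to the ends would break the symmetry.\<close>
    then have "i = 2" using sb(1) \<alpha> unfolding ra(1) by (elim disjE) (auto simp: numeral_eq_Suc)
    then have "s = r" "b = a + \<alpha>" using sb(1) unfolding ra(1) by (auto simp: numeral_eq_Suc)
    then have "gorenstein_h_vector TYPE('k) [1, r, a + \<beta>, r, 1]"
      using gorenstein_h_vector_interval[of r a "a + \<beta>"] h ra(1) sb(2) \<beta> by simp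
    then show "gorenstein_h_vector TYPE('k) (h[i := h ! i + \<beta>]) \<and> length (h[i := h ! i + \<beta>]) = 5"
      using \<open>i = 2\<close> unfolding ra(1) by (simp add: numeral_eq_Suc)
  qed
next
  fix r a b
  assume "gorenstein_h_vector TYPE('k) [1, r, a, r, 1]" "a \<le> b \<and> b \<le> (r + 1) choose 2"
  then show "gorenstein_h_vector TYPE('k) [1, r, b, r, 1]"
    using gorenstein_h_vector_interval by blast
next
  fix r b
  assume b: "b > (r + 1) choose 2"
  show "\<not> gorenstein_h_vector TYPE('k) [1, r, b, r, 1]"
  proof
    assume "gorenstein_h_vector TYPE('k) [1, r, b, r, 1]"
    then obtain s a where "[1, r, b, r, 1] = [1, s, a, s, 1]" "a \<le> (s + 1) choose 2"
      by (rule gorenstein_h_vector_socle_degree_4) simp_all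
    then show False using b by simp
  qed
qed

end
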